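(* Let $f$ be a real-valued function on $[2,\infty)$ whose derivative $f'(t)$ exists and is continuous. Then $$\sum_{p\le n} f(p)=\frac{n f(n)}{\log(n)}+O\left(\frac{n|f(n)|}{\log^2(n)}\right)-\int_2^n\frac{t f'(t)}{\log(t)}\,dt+O\left(\int_2^n\frac{t|f'(t)|}{\log^2(t)}\,dt\right).$$
   Context: The sum $\sum_{p\le n}$ runs over the primes $p\le n$, where $n\ge 2$ is a natural number; $\log$ is the natural logarithm and $\log^2(t)=(\log t)^2$. Each symbol $O(g(n))$ (with $g\ge 0$) denotes a quantity bounded in absolute value by $C g(n)$ for all $n\geq 2$, where $C$ is a constant not depending on $n$. *)

theory Defs
  imports "HOL-Analysis.Analysis" "HOL-Computational_Algebra.Primes"
begin

text \<open>Unlike the asymptotic Landau symbol of the library, the bound is required for every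
  \<open>n \<ge> 2\<close> and not just eventually.\<close>

definition bigO_ge2 :: "(nat \<Rightarrow> real) \<Rightarrow> (nat \<Rightarrow> real) set" where
  "bigO_ge2 g = {h. \<exists>C. \<forall>n\<ge>2. \<bar>h n\<bar> \<le> C * g n}"

end

theory Submission
  imports Defs "HOL-Complex_Analysis.Complex_Analysis" "HOL-Number_Theory.Prime_Powers" "HOL-Real_Asymp.Real_Asymp"
begin

text \<open>
  Since no prime is below 2, partial summation gives
  \<open>(\<Sum>p\<le>n. f p) = \<pi>(n) f(n) - integral {2..n} (\<lambda>t. \<pi>(t) f' t)\<close>
  (\<open>prime_sum_by_parts\<close>). Writing \<open>\<pi>(t) = t / ln t + R(t)\<close>, the two error terms of the
  theorem are \<open>R(n) f(n)\<close> and \<open>- integral {2..n} (\<lambda>t. R t * f' t)\<close>, so everything rests on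
  \<open>R(t) = O(t / (ln t)\<^sup>2)\<close> (\<open>prime_count_error_bound\<close>). The case \<open>f = 1\<close> shows that this
  strengthening of the prime number theorem cannot be avoided.

  It is proved by complex analysis. The function \<open>Z(s) = (s - 1) \<zeta>(s)\<close> is
  represented by a series that converges absolutely for \<open>Re s \<ge> 79/80\<close>, whence \<open>Z\<close> and \<open>Z'\<close> grow at
  most like \<open>\<bar>Im s\<bar>\<close> times a tiny power of \<open>\<bar>Im s\<bar>\<close> (\<open>zeta_reg_bounds\<close>). The 3-4-1 inequality then
  gives a zero-free region of width \<open>c / T powr (1/8)\<close> up to height \<open>T\<close>, together with a bound for
  \<open>Z' / Z\<close> there (\<open>zero_free_region\<close>). This width is far smaller than the classical \<open>c / ln T\<close>, but
  the heights used below are only powers of \<open>ln X\<close>, so that a small power of \<open>T\<close> is as good as a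
  logarithm.

  A truncated Perron formula expresses \<open>\<Sum>n\<le>X. (\<Lambda>(n) - 1) (1 - n / X)\<close> as an integral of
  \<open>D(s) X\<^sup>s / (s (s + 1))\<close> along \<open>Re s = 1 + 1 / ln X\<close> (\<open>perron_err\<close>), where
  \<open>D = - \<zeta>' / \<zeta> - \<zeta>\<close> has no pole at 1. Shifting the integral, cut at height \<open>T = (ln X) ^ 4\<close>, into
  the zero-free region saves a factor \<open>exp (- c * sqrt (ln X))\<close>; with the truncation errors the sum is
  \<open>O(X / (ln X)\<^sup>2)\<close> (\<open>smoothed_err_bigo\<close>). Since \<open>\<Lambda> \<ge> 0\<close>, differencing over
  steps of length \<open>X / ln X\<close> removes the smoothing and yields \<open>\<psi>(X) = X + O(X / ln X)\<close>
  (\<open>chebyshev_psi_asymptotic\<close>). Prime powers contribute little to \<open>\<psi>\<close>, and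
  the passage from \<open>\<theta>\<close> to \<open>\<pi>\<close> (\<open>prime_count_bound\<close>) gains another factor \<open>ln X\<close>.
\<close>

section \<open>The function \<open>(s - 1) \<zeta>(s)\<close> to the left of the line \<open>Re s = 1\<close>\<close>

lemma norm_of_nat_powr [simp]: "cmod (of_nat n powr s) = real n powr Re s"
  using norm_powr_real_powr[of "of_nat n" s] by simp

lemma segment_field_derivative_bound:
  fixes f f' :: "complex \<Rightarrow> complex"
  assumes "0 < a" "a \<le> x"
    and der: "\<And>y. a \<le> y \<Longrightarrow> y \<le> x \<Longrightarrow> (f has_field_derivative f' (of_real y)) (at (of_real y))"
    and bd: "\<And>y. a \<le> y \<Longrightarrow> y \<le> x \<Longrightarrow> cmod (f' (of_real y)) \<le> B"
  shows "cmod (f (of_real x) - f (of_real a)) \<le> B * (x - a)"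
proof -
  let ?S = "closed_segment (of_real a) (of_real x) :: complex set"
  have S: "\<exists>y. a \<le> y \<and> y \<le> x \<and> z = of_real y" if "z \<in> ?S" for z
    using that \<open>a \<le> x\<close> by (auto simp: closed_segment_of_real closed_segment_eq_real_ivl)
  have "cmod (f (of_real x) - f (of_real a)) \<le> B * cmod (of_real x - of_real a)"
  proof (rule field_differentiable_bound[where S = ?S])
    show "(f has_field_derivative f' z) (at z within ?S)" if "z \<in> ?S" for z
      using S[OF that] der has_field_derivative_at_within by blast
    show "cmod (f' z) \<le> B" if "z \<in> ?S" for z
      using S[OF that] bd by blast
  qed auto
  also have "cmod (of_real x - of_real a) = x - a"
    using \<open>a \<le> x\<close> by (simp flip: of_real_diff)
  finally show ?thesis .
qed

text \<open>
  For \<open>n \<le> x \<le> n + 1\<close> the trivial bound for the difference is \<open>2 n powr (- Re s)\<close>, and the mean value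
  theorem bounds it by \<open>\<bar>s\<bar> / n\<close> times \<open>n powr (- Re s)\<close>. Interpolating with exponent \<open>\<theta>\<close>
  trades decay in \<open>n\<close> against growth in \<open>s\<close>.
\<close>
lemma powr_diff_bound:
  assumes n: "n \<ge> 1" and s: "Re s \<ge> 0" and th: "0 \<le> \<theta>" "\<theta> \<le> 1"
    and x: "real n \<le> x" "x \<le> real (Suc n)"
  shows "cmod (of_nat n powr (-s) - of_real x powr (-s)) \<le> 2 * cmod s powr \<theta> * real n powr (- Re s - \<theta>)"
proof -
  have n0: "real n > 0" "x > 0" using n x by auto
  have nx: "cmod (complex_of_real y powr w) = y powr Re w" if "y > 0" for y w
    using norm_powr_real_powr[of "of_real y" w] that by simp
  define q where "q = cmod s / real n"
  have d1: "cmod (of_nat n powr (-s) - of_real x powr (-s)) \<le> 2 * real n powr (- Re s)"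
  proof -
    have "cmod (of_nat n powr (-s) - of_real x powr (-s)) \<le> real n powr (-Re s) + x powr (-Re s)"
      using norm_triangle_ineq4[of "of_nat n powr (-s)" "of_real x powr (-s)"] n0 by (simp add: nx)
    also have "x powr (-Re s) \<le> real n powr (-Re s)"
      using n0 x s by (intro powr_mono2') auto
    finally show ?thesis by simp
  qed
  have d2: "cmod (of_nat n powr (-s) - of_real x powr (-s)) \<le> q * real n powr (- Re s)"
  proof -
    have "cmod ((\<lambda>z. z powr (-s)) (of_real x) - (\<lambda>z. z powr (-s)) (of_real (real n)))
       \<le> (cmod s * real n powr (- Re s - 1)) * (x - real n)"
    proof (rule segment_field_derivative_bound[where f' = "\<lambda>z. (-s) * z powr (-s - 1)"])
      fix y assume y: "real n \<le> y" "y \<le> x"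
      then have "y > 0" using n0 by auto
      then show "((\<lambda>z. z powr - s) has_field_derivative - s * complex_of_real y powr (- s - 1)) (at (complex_of_real y))"
        by (intro has_field_derivative_powr) (auto simp: complex_nonpos_Reals_iff)
      have "y powr (- Re s - 1) \<le> real n powr (- Re s - 1)"
        using n0 y s by (intro powr_mono2') auto
      then show "cmod (- s * complex_of_real y powr (- s - 1)) \<le> cmod s * real n powr (- Re s - 1)"
        using \<open>y > 0\<close> by (simp add: norm_mult nx mult_left_mono)
    qed (use n0 x in auto)
    also have "\<dots> \<le> (cmod s * real n powr (- Re s - 1)) * 1"
      using x by (intro mult_left_mono) auto
    also have "\<dots> = q * real n powr (- Re s)"
      using n0 by (simp add: q_def powr_diff)
    finally show ?thesis by (simp add: norm_minus_commute)
  qed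
  have "min 2 q \<le> 2 * q powr \<theta>"
  proof (cases "q \<le> 1")
    case True
    have q0: "q \<ge> 0" by (simp add: q_def)
    have "q \<le> q powr \<theta>" if "q > 0"
      using True that th powr_mono'[of \<theta> 1 q] by simp
    then show ?thesis using q0 by (cases "q = 0") auto
  next
    case False
    then show ?thesis using ge_one_powr_ge_zero[of q \<theta>] th by linarith
  qed
  then have "min 2 q * real n powr (- Re s) \<le> 2 * q powr \<theta> * real n powr (- Re s)"
    by (intro mult_right_mono) auto
  moreover have "q powr \<theta> = cmod s powr \<theta> / real n powr \<theta>"
    by (simp add: q_def powr_divide)
  ultimately show ?thesis
    using d1 d2 n0 by (auto simp: min_def powr_diff split: if_splits)
qed

text \<open>
  These are the terms \<open>(s - 1) n powr (-s)\<close> of \<open>(s - 1) \<zeta>(s)\<close>, corrected by the integral of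
  \<open>(1 - s) x powr (-s)\<close> over \<open>n \<le> x \<le> n + 1\<close>, which makes their sum converge to the left of the line
  \<open>Re s = 1\<close>; the corrections telescope. As \<open>0 powr w = 0\<close>, the term for \<open>n = 0\<close> is the constant
  \<open>1\<close>, which is what the telescoping leaves over.
\<close>
definition zeta_term :: "nat \<Rightarrow> complex \<Rightarrow> complex" where
  "zeta_term n s = (s - 1) * of_nat n powr (-s) + of_nat (Suc n) powr (1 - s) - of_nat n powr (1 - s)"

lemma zeta_term_0 [simp]: "zeta_term 0 s = 1"
  by (simp add: zeta_term_def)

lemma norm_zeta_term_le:
  assumes n: "n \<ge> 1" and s: "Re s \<ge> 0" and th: "0 \<le> \<theta>" "\<theta> \<le> 1"
  shows "cmod (zeta_term n s) \<le> cmod (s - 1) * (2 * cmod s powr \<theta> * real n powr (- Re s - \<theta>))"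
proof -
  define B where "B = cmod (s - 1) * (2 * cmod s powr \<theta> * real n powr (- Re s - \<theta>))"
  define f where "f = (\<lambda>z. (s - 1) * (z - of_nat n) * of_nat n powr (-s) + z powr (1 - s) - of_nat n powr (1 - s))"
  have "cmod (f (of_real (real (Suc n))) - f (of_real (real n))) \<le> B * (real (Suc n) - real n)"
  proof (rule segment_field_derivative_bound[where f' = "\<lambda>z. (s - 1) * (of_nat n powr (-s) - z powr (-s))"])
    fix y assume y: "real n \<le> y" "y \<le> real (Suc n)"
    then have "y > 0" using n by auto
    then have "((\<lambda>z. z powr (1 - s)) has_field_derivative (1 - s) * complex_of_real y powr (1 - s - 1)) (at (complex_of_real y))"
      by (intro has_field_derivative_powr) (auto simp: complex_nonpos_Reals_iff)
    then show "(f has_field_derivative (s - 1) * (of_nat n powr - s - complex_of_real y powr - s)) (at (complex_of_real y))"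
      unfolding f_def using \<open>y > 0\<close> by (auto intro!: derivative_eq_intros simp: algebra_simps)
    show "cmod ((s - 1) * (of_nat n powr - s - complex_of_real y powr - s)) \<le> B"
      unfolding B_def norm_mult by (intro mult_left_mono powr_diff_bound) (use n s th y in auto)
  qed (use n in auto)
  then show ?thesis
    by (simp add: f_def zeta_term_def B_def)
qed

definition zeta_sum_const :: real where
  "zeta_sum_const = (\<Sum>n. real n powr (-81/80))"

text \<open>
  Taking \<open>\<theta> = 1/40\<close> at distance at most \<open>1/80\<close> to the left of the line \<open>Re s = 1\<close> leaves the summable
  exponent \<open>-81/80\<close> at the price of only \<open>cmod s powr (1/40)\<close>.
\<close>
lemma norm_zeta_term_le_summable:
  assumes "n \<ge> 1" "Re s \<ge> 79/80"
  shows "cmod (zeta_term n s) \<le> 2 * cmod (s - 1) * cmod s powr (1/40) * real n powr (-81/80)"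
proof -
  have "cmod (zeta_term n s) \<le> cmod (s - 1) * (2 * cmod s powr (1/40) * real n powr (- Re s - 1/40))"
    using assms by (intro norm_zeta_term_le) auto
  also have "real n powr (- Re s - 1/40) \<le> real n powr (-81/80)"
    using assms by (intro powr_mono) auto
  finally show ?thesis by (simp add: mult_left_mono)
qed

lemma summable_81_80: "summable (\<lambda>n. real n powr (-81/80))"
  by (simp add: summable_real_powr_iff)

lemma zeta_sum_const_nonneg: "zeta_sum_const \<ge> 0"
  unfolding zeta_sum_const_def by (intro suminf_nonneg summable_81_80) auto

text \<open>The entire function \<open>(s - 1) \<zeta>(s)\<close>, on the half-plane \<open>Re s \<ge> 79/80\<close>.\<close>
definition zeta_reg :: "complex \<Rightarrow> complex" where
  "zeta_reg s = (\<Sum>n. zeta_term n s)"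

abbreviation "zeta_halfplane \<equiv> {s. Re s > 79/80}"

lemma summable_zeta_term:
  assumes "Re s \<ge> 79/80"
  shows "summable (\<lambda>n. cmod (zeta_term n s))"
proof (rule summable_comparison_test')
  show "summable (\<lambda>n. 2 * cmod (s - 1) * cmod s powr (1/40) * real n powr (-81/80))"
    by (intro summable_mult summable_81_80)
  show "norm (cmod (zeta_term n s)) \<le> 2 * cmod (s - 1) * cmod s powr (1/40) * real n powr (-81/80)" if "n \<ge> 1" for n
    using norm_zeta_term_le_summable[OF that assms] by simp
qed

lemma norm_zeta_reg_minus_1_le:
  assumes "Re s \<ge> 79/80"
  shows "cmod (zeta_reg s - 1) \<le> 2 * zeta_sum_const * cmod (s - 1) * cmod s powr (1/40)"
proof -
  have sm: "summable (\<lambda>n. zeta_term n s)"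
    using summable_zeta_term[OF assms] by (rule summable_norm_cancel)
  have "zeta_reg s - 1 = (\<Sum>n. zeta_term (Suc n) s)"
    unfolding zeta_reg_def using suminf_split_head[OF sm] by simp
  also have "cmod \<dots> \<le> (\<Sum>n. 2 * cmod (s - 1) * cmod s powr (1/40) * real (Suc n) powr (-81/80))"
  proof (rule norm_suminf_le)
    show "summable (\<lambda>n. 2 * cmod (s - 1) * cmod s powr (1/40) * real (Suc n) powr (-81/80))"
      by (subst summable_Suc_iff) (intro summable_mult summable_81_80)
  qed (use assms in \<open>intro norm_zeta_term_le_summable, auto\<close>)
  also have "\<dots> = 2 * cmod (s - 1) * cmod s powr (1/40) * (\<Sum>n. real (Suc n) powr (-81/80))"
    by (rule suminf_mult) (use summable_81_80 summable_Suc_iff[of "\<lambda>n. real n powr (-81/80)"] in blast)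
  also have "(\<Sum>n. real (Suc n) powr (-81/80)) = zeta_sum_const"
    unfolding zeta_sum_const_def using suminf_split_head[OF summable_81_80] by simp
  finally show ?thesis by (simp add: mult_ac)
qed

lemma holomorphic_zeta_term [holomorphic_intros]: "zeta_term n holomorphic_on A"
proof (cases "n = 0")
  case True
  have "zeta_term 0 = (\<lambda>_. 1)" by (simp add: fun_eq_iff)
  with True show ?thesis by simp
next
  case False
  have [simp]: "1 + of_nat n \<noteq> (0 :: complex)"
    using of_nat_neq_0 by (metis of_nat_Suc)
  show ?thesis unfolding zeta_term_def[abs_def]
    using False by (intro holomorphic_intros) auto
qed

lemma holomorphic_zeta_reg: "zeta_reg holomorphic_on zeta_halfplane"
proof (rule holomorphic_uniform_sequence)
  show op: "open zeta_halfplane" by (rule open_halfspace_Re_gt)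
  show "(\<lambda>s. \<Sum>n<N. zeta_term n s) holomorphic_on zeta_halfplane" for N
    by (intro holomorphic_intros)
  fix s assume "s \<in> zeta_halfplane"
  then obtain d where d: "d > 0" "cball s d \<subseteq> zeta_halfplane"
    using op open_contains_cball_eq by blast
  define R where "R = cmod s + d + 1"
  have R: "cmod w \<le> R" "cmod (w - 1) \<le> R" if "w \<in> cball s d" for w
  proof -
    have "cmod (w - s) \<le> d" using that by (simp add: dist_norm norm_minus_commute)
    then have "cmod w \<le> cmod s + d" using norm_triangle_sub[of w s] by linarith
    then show "cmod w \<le> R" "cmod (w - 1) \<le> R"
      using norm_triangle_ineq4[of w 1] by (auto simp: R_def)
  qed
  have "uniform_limit (cball s d) (\<lambda>N w. \<Sum>n<N. zeta_term n w) (\<lambda>w. \<Sum>n. zeta_term n w) sequentially"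
  proof (rule Weierstrass_m_test_ev)
    show "\<forall>\<^sub>F n in sequentially. \<forall>w\<in>cball s d. cmod (zeta_term n w) \<le> 2 * R * R powr (1/40) * real n powr (-81/80)"
    proof (rule eventually_mono[OF eventually_ge_at_top[of 1]], safe)
      fix n :: nat and w assume n: "n \<ge> 1" and w: "w \<in> cball s d"
      have "Re w \<ge> 79/80" using d w by force
      then have "cmod (zeta_term n w) \<le> 2 * cmod (w - 1) * cmod w powr (1/40) * real n powr (-81/80)"
        by (rule norm_zeta_term_le_summable[OF n])
      also have "\<dots> \<le> 2 * R * R powr (1/40) * real n powr (-81/80)"
        using R[OF w] order_trans[OF norm_ge_zero R(1)[OF w]] by (intro mult_right_mono mult_mono powr_mono2) auto
      finally show "cmod (zeta_term n w) \<le> 2 * R * R powr (1/40) * real n powr (-81/80)" .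
    qed
    show "summable (\<lambda>n. 2 * R * R powr (1/40) * real n powr (-81/80))"
      by (intro summable_mult summable_81_80)
  qed
  then show "\<exists>d>0. cball s d \<subseteq> zeta_halfplane \<and>
      uniform_limit (cball s d) (\<lambda>N s. \<Sum>n<N. zeta_term n s) zeta_reg sequentially"
    using d by (auto simp: zeta_reg_def[abs_def])
qed

lemma zeta_reg_1 [simp]: "zeta_reg 1 = 1"
  using norm_zeta_reg_minus_1_le[of 1] by simp

lemma summable_norm_of_nat_powr:
  assumes "Re s > 1"
  shows "summable (\<lambda>n. cmod (of_nat n powr (-s)))"
  using assms by (simp add: summable_real_powr_iff)

text \<open>The partial sums telescope to \<open>(s - 1) (\<Sum>n<N. n powr (-s)) + N powr (1 - s)\<close>.\<close>
lemma zeta_reg_eq: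
  assumes "Re s > 1"
  shows "zeta_reg s = (s - 1) * (\<Sum>n. of_nat n powr (-s))"
proof -
  have part: "(\<Sum>n<N. zeta_term n s) = (s - 1) * (\<Sum>n<N. of_nat n powr (-s)) + of_nat N powr (1 - s)" for N
    by (induction N) (auto simp: zeta_term_def algebra_simps)
  have "(\<lambda>n. zeta_term n s) sums zeta_reg s"
    unfolding zeta_reg_def using assms
    by (intro summable_sums summable_norm_cancel[OF summable_zeta_term]) auto
  then have 1: "(\<lambda>N. \<Sum>n<N. zeta_term n s) \<longlonglongrightarrow> zeta_reg s" by (simp add: sums_def)
  have "(\<lambda>N. real N powr Re (1 - s)) \<longlonglongrightarrow> 0"
    by (rule tendsto_neg_powr) (use assms in \<open>auto intro: filterlim_real_sequentially\<close>)
  then have "(\<lambda>N. of_nat N powr (1 - s)) \<longlonglongrightarrow> 0"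
    by (subst tendsto_norm_zero_iff[symmetric]) simp
  moreover have "(\<lambda>N. \<Sum>n<N. of_nat n powr (-s)) \<longlonglongrightarrow> (\<Sum>n. of_nat n powr (-s))"
    using summable_norm_cancel[OF summable_norm_of_nat_powr[OF assms]] by (rule summable_LIMSEQ)
  ultimately have "(\<lambda>N. \<Sum>n<N. zeta_term n s) \<longlonglongrightarrow> (s - 1) * (\<Sum>n. of_nat n powr (-s)) + 0"
    unfolding part by (intro tendsto_intros)
  with 1 show ?thesis using LIMSEQ_unique by fastforce
qed

section \<open>Dirichlet series of the von Mangoldt function and the 3-4-1 inequality\<close>

definition zeta_series :: "complex \<Rightarrow> complex" where
  "zeta_series s = (\<Sum>n. of_nat n powr (-s))"

definition mangoldt_series :: "complex \<Rightarrow> complex" where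
  "mangoldt_series s = (\<Sum>n. mangoldt n * of_nat n powr (-s))"

lemma mangoldt_le_ln: "mangoldt n \<le> ln (real n)"
proof (cases "n = 0")
  case False
  have "mangoldt n \<le> (\<Sum>d | d dvd n. mangoldt d :: real)"
    using False by (intro member_le_sum) (auto intro: mangoldt_nonneg)
  then show ?thesis using mangoldt_sum[OF False, where 'a = real] by simp
qed simp

lemma summable_ln_powr:
  assumes "\<sigma> > 1"
  shows "summable (\<lambda>n. ln (real n) * real n powr (-\<sigma>))"
proof (rule summable_comparison_test')
  define e where "e = (\<sigma> - 1) / 2"
  have e: "e > 0" using assms by (simp add: e_def)
  show "summable (\<lambda>n. real n powr (e - \<sigma>) / e)"
    using assms by (intro summable_divide) (simp add: summable_real_powr_iff e_def field_simps)
  show "norm (ln (real n) * real n powr (-\<sigma>)) \<le> real n powr (e - \<sigma>) / e" if "n \<ge> 1" for n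
  proof -
    have "ln (real n) * real n powr (-\<sigma>) \<le> real n powr e / e * real n powr (-\<sigma>)"
      using that e by (intro mult_right_mono ln_powr_bound) auto
    also have "\<dots> = real n powr (e - \<sigma>) / e"
      by (simp add: powr_diff powr_minus field_simps)
    finally show ?thesis using that by simp
  qed
qed

lemma summable_mangoldt:
  assumes "Re s > 1"
  shows "summable (\<lambda>n. cmod (mangoldt n * of_nat n powr (-s)))"
proof (rule summable_comparison_test'[OF summable_ln_powr[OF assms], of 0])
  show "norm (cmod (mangoldt n * of_nat n powr (-s))) \<le> ln (real n) * real n powr (- Re s)" for n
    using mangoldt_le_ln[of n] by (simp add: norm_mult abs_mult mangoldt_nonneg mult_right_mono)
qed

text \<open>Locally uniform convergence on \<open>Re s > 1\<close> permits termwise differentiation.\<close>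
lemma zeta_series_derivative:
  assumes "Re s > 1"
  shows "(zeta_series has_field_derivative - (\<Sum>n. of_real (ln (real n)) * of_nat n powr (-s))) (at s)"
proof -
  let ?S = "{s. Re s > 1}"
  let ?f = "\<lambda>n s. of_nat n powr (-s) :: complex"
  let ?f' = "\<lambda>n s. - (of_real (ln (real n)) * of_nat n powr (-s)) :: complex"
  have op: "open ?S" by (rule open_halfspace_Re_gt)
  have "\<exists>g g'. \<forall>s\<in>?S. (\<lambda>n. ?f n s) sums g s \<and> (\<lambda>n. ?f' n s) sums g' s \<and> (g has_field_derivative g' s) (at s)"
  proof (rule series_and_derivative_comparison_complex[OF op])
    fix n :: nat and s :: complex
    show "(?f n has_field_derivative ?f' n s) (at s)"
    proof (cases "n = 0")
      case False
      then show ?thesis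
        unfolding powr_def by (auto intro!: derivative_eq_intros simp: Ln_of_nat)
    qed simp
  next
    fix s assume "s \<in> ?S"
    define d where "d = (Re s - 1) / 2"
    have d: "d > 0" using \<open>s \<in> ?S\<close> by (simp add: d_def)
    have *: "Re w \<ge> 1 + d" if "w \<in> ball s d" for w
    proof -
      have "Re s - Re w < d"
        using that complex_Re_le_cmod[of "s - w"] by (simp add: dist_norm)
      moreover have "Re s = 1 + 2 * d" by (simp add: d_def field_simps)
      ultimately show ?thesis by linarith
    qed
    show "\<exists>d h. 0 < d \<and> summable h \<and> range h \<subseteq> \<real>\<^sub>\<ge>\<^sub>0 \<and>
             (\<forall>\<^sub>F n in sequentially. \<forall>w\<in>ball s d \<inter> ?S. cmod (?f n w) \<le> cmod (h n))"
    proof (intro exI conjI)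
      show "summable (\<lambda>n. complex_of_real (real n powr (- (1 + d))))"
        using d by (intro summable_of_real) (simp add: summable_real_powr_iff)
      show "\<forall>\<^sub>F n in sequentially. \<forall>w\<in>ball s d \<inter> ?S. cmod (?f n w) \<le> cmod (complex_of_real (real n powr (- (1 + d))))"
        using eventually_ge_at_top[of 1]
        by eventually_elim (use * in \<open>force intro!: powr_mono\<close>)
    qed (use d in auto)
  qed
  then obtain g g' where g: "\<And>s. s \<in> ?S \<Longrightarrow> (\<lambda>n. ?f n s) sums g s"
    "\<And>s. s \<in> ?S \<Longrightarrow> (\<lambda>n. ?f' n s) sums g' s" "\<And>s. s \<in> ?S \<Longrightarrow> (g has_field_derivative g' s) (at s)"
    by blast
  have eq: "zeta_series w = g w" if "w \<in> ?S" for w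
    using g(1)[OF that] by (simp add: zeta_series_def sums_iff)
  have "(zeta_series has_field_derivative g' s) (at s)"
    by (rule has_field_derivative_transform_within_open[OF g(3) op]) (use assms eq in auto)
  moreover have "(\<lambda>n. of_real (ln (real n)) * of_nat n powr (-s)) sums (- g' s)"
    using sums_minus[OF g(2)[of s]] assms by simp
  ultimately show ?thesis by (simp add: sums_iff)
qed

text \<open>
  The double series of \<open>\<Lambda>(d) (d e) powr (-s)\<close> is summed along \<open>n = d e\<close>, where
  \<open>(\<Sum>d | d dvd n. \<Lambda>(d)) = ln n\<close>.
\<close>
lemma zeta_times_mangoldt:
  assumes s: "Re s > 1"
  shows "zeta_series s * mangoldt_series s = (\<Sum>n. of_real (ln (real n)) * of_nat n powr (-s))"
proof -
  let ?f = "\<lambda>n. mangoldt n * of_nat n powr (-s) :: complex"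
  let ?g = "\<lambda>n. of_nat n powr (-s) :: complex"
  let ?A = "{1::nat..}"
  have restrict: "(f has_sum a) ?A" if "(f has_sum a) UNIV" "f 0 = 0" for f :: "nat \<Rightarrow> complex" and a
  proof -
    have "(f has_sum a) ?A \<longleftrightarrow> (f has_sum a) UNIV"
        using that by (intro has_sum_cong_neutral) (auto simp: not_le)
    with that show ?thesis by simp
  qed
  have f: "(?f has_sum mangoldt_series s) ?A"
    unfolding mangoldt_series_def
    by (intro restrict norm_summable_imp_has_sum summable_sums summable_mangoldt[OF s]
          summable_norm_cancel[OF summable_mangoldt[OF s]]) auto
  have g: "(?g has_sum zeta_series s) ?A"
    unfolding zeta_series_def
    by (intro restrict norm_summable_imp_has_sum summable_sums summable_norm_of_nat_powr[OF s]
          summable_norm_cancel[OF summable_norm_of_nat_powr[OF s]]) auto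
  have fa: "(\<lambda>n. cmod (?f n)) summable_on ?A"
    by (rule summable_on_subset_banach[OF _ subset_UNIV])
       (use summable_mangoldt[OF s] in \<open>simp add: summable_on_UNIV_nonneg_real_iff\<close>)
  have ga: "(\<lambda>n. cmod (?g n)) summable_on ?A"
    by (rule summable_on_subset_banach[OF _ subset_UNIV])
       (use summable_norm_of_nat_powr[OF s] in \<open>simp add: summable_on_UNIV_nonneg_real_iff\<close>)
  have "((\<lambda>(d, e). ?f d * ?g e) has_sum (mangoldt_series s * zeta_series s)) (?A \<times> ?A)"
  proof (rule has_sum_SigmaI)
    show "((\<lambda>e. (\<lambda>(d, e). ?f d * ?g e) (d, e)) has_sum (?f d * zeta_series s)) ?A" for d
      using has_sum_cmult_right[OF g, of "?f d"] by simp
    show "((\<lambda>d. ?f d * zeta_series s) has_sum mangoldt_series s * zeta_series s) ?A"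
      by (rule has_sum_cmult_left[OF f])
    show "(\<lambda>(d, e). ?f d * ?g e) summable_on ?A \<times> ?A"
    proof (rule abs_summable_summable, subst Infinite_Sum.abs_summable_on_Sigma_iff, intro conjI ballI)
      show "(\<lambda>e. cmod (case (d, e) of (d, e) \<Rightarrow> ?f d * ?g e)) summable_on ?A" for d
        using summable_on_cmult_right[OF ga, of "cmod (?f d)"] by (simp add: norm_mult)
      show "(\<lambda>d. norm (\<Sum>\<^sub>\<infinity>e\<in>?A. cmod (case (d, e) of (d, e) \<Rightarrow> ?f d * ?g e))) summable_on ?A"
        using summable_on_cmult_left[OF fa, of "infsum (\<lambda>e. cmod (?g e)) ?A"] ga
        by (simp add: norm_mult infsum_cmult_right' infsum_nonneg abs_mult mangoldt_nonneg)
    qed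
  qed
  also have "?this \<longleftrightarrow> ((\<lambda>(n, d). mangoldt d * of_nat n powr (-s)) has_sum (mangoldt_series s * zeta_series s))
      (SIGMA n:?A. {d. d dvd n})"
  proof (rule has_sum_reindex_bij_witness[where i = "\<lambda>(n, d). (d, n div d)" and j = "\<lambda>(d, e). (d * e, d)"])
    fix p assume "p \<in> ?A \<times> ?A"
    then show "(case case p of (d, e) \<Rightarrow> (d * e, d) of (n, d) \<Rightarrow> mangoldt d * complex_of_nat n powr - s) =
         (case p of (d, e) \<Rightarrow> ?f d * ?g e)"
      by (auto simp: powr_times_real mult.assoc)
  qed (auto simp: Suc_le_eq dvd_div_eq_0_iff elim!: dvdE)
  finally have "((\<lambda>n. of_real (ln (real n)) * of_nat n powr (-s)) has_sum (mangoldt_series s * zeta_series s)) ?A"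
  proof (rule has_sum_SigmaD)
    fix n assume "n \<in> ?A"
    then have n: "n \<noteq> 0" by auto
    have "((\<lambda>d. mangoldt d * of_nat n powr (-s)) has_sum (\<Sum>d | d dvd n. mangoldt d * of_nat n powr (-s) :: complex)) {d. d dvd n}"
      using n by (intro has_sum_finite) auto
    also have "(\<Sum>d | d dvd n. mangoldt d * of_nat n powr (-s) :: complex) = of_real (ln (real n)) * of_nat n powr (-s)"
      using mangoldt_sum[OF n, where 'a = complex] by (simp flip: sum_distrib_right)
    finally show "((\<lambda>d. case (n, d) of (n, d) \<Rightarrow> mangoldt d * of_nat n powr (-s)) has_sum
        of_real (ln (real n)) * of_nat n powr (-s)) {d. d dvd n}" by simp
  qed
  also have "?this \<longleftrightarrow> ((\<lambda>n. of_real (ln (real n)) * of_nat n powr (-s)) has_sum (mangoldt_series s * zeta_series s)) UNIV"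
    by (intro has_sum_cong_neutral) (auto simp: not_le)
  finally have "(\<lambda>n. of_real (ln (real n)) * of_nat n powr (-s)) sums (mangoldt_series s * zeta_series s)"
    by (rule has_sum_imp_sums)
  then show ?thesis by (simp add: sums_iff mult.commute)
qed

text \<open>
  The identity \<open>\<zeta>' = - L \<zeta>\<close>, with \<open>L\<close> the series of \<open>\<Lambda>\<close>, is used as a differential equation,
  which holds at possible zeros of \<open>\<zeta>\<close> as well.
\<close>
lemma zeta_series_ode:
  assumes "Re s > 1"
  shows "(zeta_series has_field_derivative - (mangoldt_series s * zeta_series s)) (at s)"
  using zeta_series_derivative[OF assms] zeta_times_mangoldt[OF assms] by (simp add: mult.commute)

lemma Re_of_nat_powr:
  assumes "n \<ge> 1"
  shows "Re (of_nat n powr (- Complex \<sigma> t)) = real n powr (-\<sigma>) * cos (t * ln (real n))"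
  using assms by (simp add: powr_def Re_exp Ln_of_nat mult.commute)

text \<open>Termwise, this is \<open>3 + 4 cos \<theta> + cos (2 \<theta>) = 2 (1 + cos \<theta>)\<^sup>2 \<ge> 0\<close> with \<open>\<theta> = t ln n\<close>.\<close>
lemma mangoldt_series_341_nonneg:
  assumes "\<sigma> > 1"
  shows "0 \<le> Re (3 * mangoldt_series (Complex \<sigma> 0) + 4 * mangoldt_series (Complex \<sigma> t) + mangoldt_series (Complex \<sigma> (2 * t)))"
proof -
  let ?a = "\<lambda>u n. mangoldt n * of_nat n powr (- Complex \<sigma> u) :: complex"
  have sums: "?a u sums mangoldt_series (Complex \<sigma> u)" for u
    unfolding mangoldt_series_def using assms by (intro summable_sums summable_norm_cancel[OF summable_mangoldt]) auto
  have "(\<lambda>n. Re (3 * ?a 0 n + 4 * ?a t n + ?a (2*t) n)) sums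
      Re (3 * mangoldt_series (Complex \<sigma> 0) + 4 * mangoldt_series (Complex \<sigma> t) + mangoldt_series (Complex \<sigma> (2 * t)))"
    by (intro sums_Re sums_add sums_mult sums)
  moreover have "0 \<le> Re (3 * ?a 0 n + 4 * ?a t n + ?a (2*t) n)" for n
  proof (cases "n = 0")
    case False
    define th where "th = t * ln (real n)"
    have Re: "Re (of_nat n powr (- Complex \<sigma> u)) = real n powr (-\<sigma>) * cos (u * ln (real n))" for u
      using False by (intro Re_of_nat_powr) auto
    have "Re (3 * ?a 0 n + 4 * ?a t n + ?a (2*t) n) =
        mangoldt n * real n powr (-\<sigma>) * (3 + 4 * cos th + cos (2 * th))"
      by (simp add: th_def Re algebra_simps)
    also have "3 + 4 * cos th + cos (2 * th) = 2 * (1 + cos th) ^ 2"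
      unfolding cos_double_cos by (simp add: power2_eq_square algebra_simps)
    finally show ?thesis by (simp add: mangoldt_nonneg)
  qed simp
  ultimately show ?thesis by (rule sums_le[OF _ sums_zero, rotated]) 
qed

lemma zeta_series_tendsto_1: "((\<lambda>x. zeta_series (Complex x t)) \<longlongrightarrow> 1) at_top"
proof -
  define C where "C = (\<Sum>n. real (n + 2) powr (-2))"
  have sC: "summable (\<lambda>n. real (n + 2) powr (-2))"
    by (subst summable_iff_shift[of "\<lambda>n. real n powr (-2)"]) (simp add: summable_real_powr_iff)
  have bd: "cmod (zeta_series (Complex x t) - 1) \<le> 2 powr (2 - x) * C" if "x \<ge> 2" for x
  proof -
    let ?s = "Complex x t"
    have sm: "summable (\<lambda>n. of_nat n powr (-?s) :: complex)"
      using that by (intro summable_norm_cancel[OF summable_norm_of_nat_powr]) auto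
    have "zeta_series ?s - 1 = (\<Sum>n. of_nat (n + 2) powr (-?s))"
      unfolding zeta_series_def using suminf_split_initial_segment[OF sm, of 2]
      by (simp add: eval_nat_numeral)
    also have "cmod \<dots> \<le> (\<Sum>n. 2 powr (2 - x) * real (n + 2) powr (-2))"
    proof (rule norm_suminf_le)
      fix n :: nat
      have "real (n + 2) powr (- x) = real (n + 2) powr (2 - x) * real (n + 2) powr (-2)"
        by (simp flip: powr_add)
      also have "real (n + 2) powr (2 - x) \<le> 2 powr (2 - x)"
        using that by (intro powr_mono2') auto
      finally show "cmod (of_nat (n + 2) powr (-?s)) \<le> 2 powr (2 - x) * real (n + 2) powr (-2)"
        unfolding norm_of_nat_powr by (simp add: mult_right_mono)
    qed (intro summable_mult sC)
    also have "\<dots> = 2 powr (2 - x) * C"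
      unfolding C_def by (rule suminf_mult[OF sC])
    finally show ?thesis .
  qed
  have "((\<lambda>x. 2 powr (2 - x) * C) \<longlongrightarrow> 0) at_top"
    by real_asymp
  then have "((\<lambda>x. zeta_series (Complex x t) - 1) \<longlongrightarrow> 0) at_top"
    by (rule Lim_null_comparison[rotated]) (use bd in \<open>auto intro: eventually_mono[OF eventually_ge_at_top[of 2]]\<close>)
  then show ?thesis using Lim_null by blast
qed

text \<open>
  With \<open>\<sigma>\<close> as variable, the product \<open>G\<close> of the values of \<open>\<zeta>\<close> satisfies \<open>G' = - M G\<close> where \<open>Re M \<ge> 0\<close> by
  the preceding positivity. Hence \<open>\<bar>G\<bar>\<^sup>2\<close> is nonincreasing in \<open>\<sigma>\<close>, and it tends to 1. In
  particular \<open>\<zeta>\<close> has no zeros for \<open>\<sigma> > 1\<close>.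
\<close>
lemma zeta_series_341:
  assumes "\<sigma> > 1"
  shows "1 \<le> cmod (zeta_series (Complex \<sigma> 0)) ^ 3 * cmod (zeta_series (Complex \<sigma> t)) ^ 4 * cmod (zeta_series (Complex \<sigma> (2 * t)))"
proof -
  define w where "w = Complex 0"
  define G where "G = (\<lambda>z. zeta_series (z + w 0) ^ 3 * zeta_series (z + w t) ^ 4 * zeta_series (z + w (2 * t)))"
  define M where "M = (\<lambda>x. 3 * mangoldt_series (Complex x 0) + 4 * mangoldt_series (Complex x t) + mangoldt_series (Complex x (2 * t)))"
  have cplx: "complex_of_real x + w u = Complex x u" for x u
    by (simp add: w_def complex_eq_iff)
  define h where "h = (\<lambda>x. G (of_real x) \<bullet> G (of_real x))"
  have derG: "(G has_field_derivative - M x * G (of_real x)) (at (of_real x))" if "x > 1" for x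
  proof -
    have z: "((\<lambda>z. zeta_series (z + w u)) has_field_derivative
         - (mangoldt_series (Complex x u) * zeta_series (Complex x u))) (at (of_real x))" for u
      using DERIV_shift[of zeta_series "- (mangoldt_series (Complex x u) * zeta_series (Complex x u))" "of_real x" "w u"]
        zeta_series_ode[of "Complex x u"] that by (simp add: cplx)
    show ?thesis unfolding G_def
      by (rule derivative_eq_intros z refl)+ (simp add: M_def cplx algebra_simps power_numeral_reduce)
  qed
  have derh: "(h has_real_derivative - 2 * Re (M x) * h x) (at x)" if "x > 1" for x
  proof -
    have "((\<lambda>x. G (of_real x)) has_vector_derivative - M x * G (of_real x)) (at x)"
      using derG[OF that] by (rule has_vector_derivative_real_field)
    then have "((\<lambda>x. G (of_real x)) has_derivative (\<lambda>h. h *\<^sub>R (- M x * G (of_real x)))) (at x)"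
      by (simp add: has_vector_derivative_def)
    from has_derivative_inner[OF this this] show ?thesis
      unfolding h_def has_field_derivative_def
      by (rule has_derivative_eq_rhs) (auto simp: inner_complex_def algebra_simps)
  qed
  have mono: "h y \<le> h \<sigma>" if "y \<ge> \<sigma>" for y
  proof (rule DERIV_nonpos_imp_nonincreasing[OF that])
    fix x assume "\<sigma> \<le> x" "x \<le> y"
    then have "x > 1" using assms by simp
    then have "Re (M x) \<ge> 0" "h x \<ge> 0"
      using mangoldt_series_341_nonneg[of x t] by (simp_all add: M_def h_def)
    then have "- 2 * Re (M x) * h x \<le> 0"
      using mult_nonneg_nonneg[of "Re (M x)" "h x"] by simp
    with derh[OF \<open>x > 1\<close>] show "\<exists>d. (h has_real_derivative d) (at x) \<and> d \<le> 0" by blast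
  qed
  have "((\<lambda>x. G (of_real x)) \<longlongrightarrow> 1 ^ 3 * 1 ^ 4 * 1) at_top"
    unfolding G_def cplx by (intro tendsto_intros zeta_series_tendsto_1)
  then have "(h \<longlongrightarrow> (1 ^ 3 * 1 ^ 4 * 1) \<bullet> (1 ^ 3 * 1 ^ 4 * (1::complex))) at_top"
    unfolding h_def by (intro tendsto_intros)
  then have "(h \<longlongrightarrow> 1) at_top" by simp
  then have "1 \<le> h \<sigma>"
    by (rule tendsto_upperbound) (auto intro: eventually_mono[OF eventually_ge_at_top[of \<sigma>]] mono)
  then have "1 \<le> cmod (G (of_real \<sigma>)) ^ 2"
    unfolding h_def by (simp add: power2_norm_eq_inner)
  then have "1 \<le> cmod (G (of_real \<sigma>))"
    by (smt (verit) norm_ge_zero one_le_power power2_le_imp_le power_one)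
  then show ?thesis
    unfolding G_def cplx by (simp add: norm_mult norm_power)
qed

section \<open>A zero-free region\<close>

text \<open>The summand 3 makes \<open>height s\<close> dominate both \<open>cmod s\<close> and \<open>cmod (s - 1)\<close> for \<open>0 \<le> Re s \<le> 3\<close>.\<close>
definition height :: "complex \<Rightarrow> real" where "height s = \<bar>Im s\<bar> + 3"

lemma height_ge_3: "height s \<ge> 3" by (simp add: height_def)

text \<open>The bound for the derivative is Cauchy's inequality on circles of radius \<open>1/200\<close>.\<close>
lemma zeta_reg_bounds:
  obtains C where "C \<ge> 1"
    "\<And>s. 159/160 \<le> Re s \<Longrightarrow> Re s \<le> 2 \<Longrightarrow> cmod (zeta_reg s) \<le> C * height s * height s powr (1/40)"
    "\<And>s. 159/160 \<le> Re s \<Longrightarrow> Re s \<le> 2 \<Longrightarrow> cmod (deriv zeta_reg s) \<le> C * height s * height s powr (1/40)"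
proof -
  define C where "C = 1 + 2 * zeta_sum_const"
  have C1: "C \<ge> 1" using zeta_sum_const_nonneg by (simp add: C_def)
  have A: "cmod (zeta_reg s) \<le> C * height s * height s powr (1/40)" if "79/80 \<le> Re s" "Re s \<le> 3" for s
  proof -
    have "cmod (s - 1) \<le> \<bar>Re (s - 1)\<bar> + \<bar>Im (s - 1)\<bar>" by (rule cmod_le)
    also have "\<dots> \<le> height s" using that by (simp add: height_def)
    finally have 1: "cmod (s - 1) \<le> height s" .
    have "cmod s \<le> \<bar>Re s\<bar> + \<bar>Im s\<bar>" by (rule cmod_le)
    also have "\<dots> \<le> height s" using that by (simp add: height_def)
    finally have 2: "cmod s \<le> height s" .
    have p: "height s powr (1/40) \<ge> 1" using height_ge_3[of s] by (intro ge_one_powr_ge_zero) auto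
    have "cmod (zeta_reg s) \<le> 1 + cmod (zeta_reg s - 1)"
      using norm_triangle_sub[of "zeta_reg s" 1] by simp
    also have "cmod (zeta_reg s - 1) \<le> 2 * zeta_sum_const * cmod (s - 1) * cmod s powr (1/40)"
      using that by (intro norm_zeta_reg_minus_1_le) auto
    also have "\<dots> \<le> 2 * zeta_sum_const * height s * height s powr (1/40)"
      using 1 2 zeta_sum_const_nonneg height_ge_3[of s] by (intro mult_mono powr_mono2 order_refl) auto
    finally have "cmod (zeta_reg s) \<le> 1 + 2 * zeta_sum_const * height s * height s powr (1/40)" by simp
    moreover have "1 \<le> height s * height s powr (1/40)"
      using p height_ge_3[of s] mult_mono[of 1 "height s" 1 "height s powr (1/40)"] by simp
    ultimately show ?thesis by (simp add: C_def algebra_simps)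
  qed
  have B: "cmod (deriv zeta_reg s) \<le> (800 * C) * height s * height s powr (1/40)" if s: "159/160 \<le> Re s" "Re s \<le> 2" for s
  proof -
    have near: "79/80 < Re w \<and> Re w \<le> 3 \<and> height w \<le> 2 * height s" if "w \<in> cball s (1/200)" for w
    proof -
      have "cmod (w - s) \<le> 1/200" using that by (simp add: dist_norm norm_minus_commute)
      then have *: "\<bar>Re w - Re s\<bar> \<le> 1/200" "\<bar>Im w - Im s\<bar> \<le> 1/200"
        using abs_Re_le_cmod[of "w - s"] abs_Im_le_cmod[of "w - s"] by auto
      have "\<bar>Im w\<bar> - \<bar>Im s\<bar> \<le> 1/200"
        using order_trans[OF abs_triangle_ineq2 *(2)] .
      then have "height w \<le> 2 * height s" using abs_ge_zero[of "Im s"] unfolding height_def by argo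
      moreover have "79/80 < Re w" "Re w \<le> 3" using *(1) s by linarith+
      ultimately show ?thesis by simp
    qed
    have sub: "cball s (1/200) \<subseteq> zeta_halfplane" using near by auto
    have "cmod ((deriv ^^ 1) zeta_reg s) \<le> fact 1 * (C * (2 * height s) * (2 * height s powr (1/40))) / (1/200) ^ 1"
    proof (rule Cauchy_inequality)
      show "zeta_reg holomorphic_on ball s (1/200)" 
        using holomorphic_zeta_reg sub ball_subset_cball holomorphic_on_subset by blast
      show "continuous_on (cball s (1/200)) zeta_reg"
        using holomorphic_on_imp_continuous_on[OF holomorphic_zeta_reg] sub continuous_on_subset by blast
      fix w assume "cmod (s - w) = 1/200"
      then have w: "w \<in> cball s (1/200)" by (simp add: dist_norm)
      have "cmod (zeta_reg w) \<le> C * height w * height w powr (1/40)"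
        using near[OF w] by (intro A) auto
      also have "height w powr (1/40) \<le> (2 * height s) powr (1/40)"
        using near[OF w] height_ge_3[of w] by (intro powr_mono2) auto
      also have "(2 * height s) powr (1/40) = 2 powr (1/40) * height s powr (1/40)"
        by (simp add: powr_mult)
      also have "2 powr (1/40) \<le> (2 powr 1 :: real)" by (rule powr_mono) auto
      finally have "cmod (zeta_reg w) \<le> C * height w * (2 * height s powr (1/40))"
        using C1 height_ge_3[of w] by (simp add: mult_left_mono mult_right_mono)
      also have "\<dots> \<le> C * (2 * height s) * (2 * height s powr (1/40))"
        using near[OF w] C1 by (intro mult_right_mono mult_left_mono) auto
      finally show "cmod (zeta_reg w) \<le> C * (2 * height s) * (2 * height s powr (1/40))" .
    qed auto
    then show ?thesis by simp
  qed
  show ?thesis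
  proof (rule that[of "800 * C"])
    fix s assume s: "159/160 \<le> Re s" "Re s \<le> 2"
    have "cmod (zeta_reg s) \<le> C * (height s * height s powr (1/40))"
      using A[of s] s by (simp add: mult_ac)
    also have "\<dots> \<le> 800 * C * (height s * height s powr (1/40))"
      using C1 height_ge_3[of s] by (intro mult_right_mono) auto
    finally show "cmod (zeta_reg s) \<le> 800 * C * height s * height s powr (1/40)" by (simp add: mult_ac)
  qed (use B C1 in auto)
qed

text \<open>
  Multiplying by \<open>s - 1\<close> turns \<open>\<zeta>\<close> into \<open>zeta_reg\<close>, and the values at \<open>\<sigma>\<close> and \<open>\<sigma> + 2 t \<i>\<close> are replaced
  by their upper bounds; what remains bounds the value at \<open>\<sigma> + t \<i>\<close> from below.
\<close>
lemma zeta_reg_341: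
  assumes "C \<ge> 1"
    and bd: "\<And>s. 159/160 \<le> Re s \<Longrightarrow> Re s \<le> 2 \<Longrightarrow> cmod (zeta_reg s) \<le> C * height s * height s powr (1/40)"
    and \<sigma>: "1 < \<sigma>" "\<sigma> \<le> 2"
  shows "(\<sigma> - 1) ^ 3 * \<bar>t\<bar> ^ 5 \<le> 2916 * C ^ 4 * (\<bar>t\<bar> + 3) * (\<bar>t\<bar> + 3) powr (1/40) * cmod (zeta_reg (Complex \<sigma> t)) ^ 4"
proof -
  have C0 [simp]: "0 \<le> C" using \<open>C \<ge> 1\<close> by simp
  define z where "z = (\<lambda>u. cmod (zeta_series (Complex \<sigma> u)))"
  define Z where "Z = (\<lambda>u. cmod (zeta_reg (Complex \<sigma> u)))"
  define b where "b = (\<lambda>u. cmod (Complex \<sigma> u - 1))"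
  have Z: "Z u = b u * z u" for u
    using zeta_reg_eq[of "Complex \<sigma> u"] \<sigma> by (simp add: Z_def b_def z_def zeta_series_def norm_mult)
  have b0: "b 0 = \<sigma> - 1" and bu: "b u \<ge> \<bar>u\<bar>" "b u \<ge> 0" for u
    using abs_Im_le_cmod[of "Complex \<sigma> u - 1"] \<sigma> by (auto simp: b_def cmod_def)
  have "(\<sigma> - 1) ^ 3 * \<bar>t\<bar> ^ 5 = (\<sigma> - 1) ^ 3 * \<bar>t\<bar> ^ 4 * \<bar>t\<bar> * 1"
    by (simp add: power_numeral_reduce)
  also have "\<dots> \<le> b 0 ^ 3 * b t ^ 4 * b (2 * t) * (z 0 ^ 3 * z t ^ 4 * z (2 * t))"
    using zeta_series_341[OF \<sigma>(1), of t] bu[of t] bu[of "2 * t"] \<sigma>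
    by (intro mult_mono power_mono) (auto simp: b0 z_def)
  also have "\<dots> = Z 0 ^ 3 * Z (2 * t) * Z t ^ 4"
    by (simp add: Z power_mult_distrib mult_ac)
  also have "\<dots> \<le> (C * 3 * 3) ^ 3 * (C * (2 * (\<bar>t\<bar> + 3)) * (2 * (\<bar>t\<bar> + 3) powr (1/40))) * Z t ^ 4"
  proof (intro mult_right_mono mult_mono power_mono)
    have "Z 0 \<le> C * 3 * 3 powr (1/40)"
      unfolding Z_def using bd[of "Complex \<sigma> 0"] \<sigma> by (simp add: height_def)
    also have "3 powr (1/40) \<le> (3 powr 1 :: real)" by (rule powr_mono) auto
    finally show "Z 0 \<le> C * 3 * 3" using \<open>C \<ge> 1\<close> by simp
    have "Z (2 * t) \<le> C * (\<bar>2 * t\<bar> + 3) * (\<bar>2 * t\<bar> + 3) powr (1/40)"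
      unfolding Z_def using bd[of "Complex \<sigma> (2 * t)"] \<sigma> by (simp add: height_def)
    also have "\<dots> \<le> C * (2 * (\<bar>t\<bar> + 3)) * (2 * (\<bar>t\<bar> + 3)) powr (1/40)"
      using \<open>C \<ge> 1\<close> by (intro mult_mono powr_mono2 order_refl) auto
    also have "(2 * (\<bar>t\<bar> + 3)) powr (1/40) = 2 powr (1/40) * (\<bar>t\<bar> + 3) powr (1/40)"
      by (rule powr_mult)
    also have "2 powr (1/40) \<le> (2 powr 1 :: real)" by (rule powr_mono) auto
    finally show "Z (2 * t) \<le> C * (2 * (\<bar>t\<bar> + 3)) * (2 * (\<bar>t\<bar> + 3) powr (1/40))"
      using C0 by (simp add: mult_left_mono mult_right_mono)
  qed (auto simp: Z_def)
  also have "\<dots> = 2916 * C ^ 4 * (\<bar>t\<bar> + 3) * (\<bar>t\<bar> + 3) powr (1/40) * Z t ^ 4"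
    by (simp add: power_mult_distrib power_numeral_reduce)
  finally show ?thesis by (simp add: Z_def)
qed

lemma zeta_reg_diff_bound:
  assumes bd: "\<And>s. 159/160 \<le> Re s \<Longrightarrow> Re s \<le> 2 \<Longrightarrow> cmod (deriv zeta_reg s) \<le> C * height s * height s powr (1/40)"
    and x: "159/160 \<le> x" "x \<le> y" "y \<le> 2"
  shows "cmod (zeta_reg (Complex y t) - zeta_reg (Complex x t)) \<le> C * (\<bar>t\<bar> + 3) * (\<bar>t\<bar> + 3) powr (1/40) * (y - x)"
proof -
  let ?S = "closed_segment (Complex x t) (Complex y t)"
  have S: "Im s = t" "159/160 \<le> Re s" "Re s \<le> 2" if "s \<in> ?S" for s
    using that x by (auto simp: closed_segment_same_Im closed_segment_eq_real_ivl split: if_splits)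
  have "cmod (zeta_reg (Complex y t) - zeta_reg (Complex x t)) \<le> 
     C * (\<bar>t\<bar> + 3) * (\<bar>t\<bar> + 3) powr (1/40) * cmod (Complex y t - Complex x t)"
  proof (rule field_differentiable_bound[where S = ?S])
    show "(zeta_reg has_field_derivative deriv zeta_reg s) (at s within ?S)" if "s \<in> ?S" for s
      using holomorphic_derivI[OF holomorphic_zeta_reg open_halfspace_Re_gt, of s] S[OF that]
      by (auto intro: has_field_derivative_at_within)
    show "cmod (deriv zeta_reg s) \<le> C * (\<bar>t\<bar> + 3) * (\<bar>t\<bar> + 3) powr (1/40)" if "s \<in> ?S" for s
      using bd[of s] S[OF that] by (simp add: height_def)
  qed auto
  also have "cmod (Complex y t - Complex x t) = y - x"
    using x by (simp add: cmod_def)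
  finally show ?thesis .
qed

text \<open>
  At distance \<open>\<delta>\<close> to the right of the line \<open>Re s = 1\<close> the 3-4-1 inequality bounds \<open>zeta_reg\<close> from below by
  a multiple of \<open>\<delta> powr (3/4)\<close>, whereas moving left by \<open>2 \<delta>\<close> changes it by a multiple of \<open>\<delta>\<close> only. For
  small \<open>\<delta>\<close> the lower bound survives; the powers of the height dictate the choice of \<open>\<delta>\<close>.
\<close>
lemma zeta_reg_lower_bound:
  assumes C: "C \<ge> 1"
    and bd: "\<And>s. 159/160 \<le> Re s \<Longrightarrow> Re s \<le> 2 \<Longrightarrow> cmod (zeta_reg s) \<le> C * height s * height s powr (1/40)"
    and bd': "\<And>s. 159/160 \<le> Re s \<Longrightarrow> Re s \<le> 2 \<Longrightarrow> cmod (deriv zeta_reg s) \<le> C * height s * height s powr (1/40)"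
    and a: "a = 1 / (100 * C)" and k: "k = a / (4 * C)"
    and s: "\<bar>Im s\<bar> \<ge> 1" "1 - k ^ 4 / height s powr (1/8) \<le> Re s" "Re s \<le> 2"
  shows "cmod (zeta_reg s) \<ge> a * k ^ 3 / 2 * height s / height s powr (1/10)"
proof -
  \<comment> \<open>in terms of \<open>v\<close> all exponents are natural numbers, also after taking the fourth root\<close>
  define v where "v = height s powr (1/160)"
  define \<tau> where "\<tau> = height s"
  have v1: "v \<ge> 1" unfolding v_def using height_ge_3[of s] by (intro ge_one_powr_ge_zero) auto
  have vp: "height s powr (1/40) = v ^ 4" "height s powr (1/8) = v ^ 20" "height s powr (1/10) = v ^ 16"
    using height_ge_3[of s] by (simp_all add: v_def powr_powr flip: powr_realpow)
  define t where "t = Im s"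
  have tau: "\<tau> = \<bar>t\<bar> + 3" "\<tau> \<ge> 3" "\<tau> \<le> 4 * \<bar>t\<bar>" "height s = \<tau>" using s by (auto simp: \<tau>_def height_def t_def)
  have v4: "(\<bar>t\<bar> + 3) powr (1/40) = v ^ 4" using vp tau by simp
  have a0: "a > 0" "a \<le> 1/100" using C by (auto simp: a field_simps)
  have k0: "k > 0" "k \<le> 1/400" "k \<le> 1"
  proof -
    show "k > 0" using a0 C by (simp add: k)
    have "k \<le> a / 4" unfolding k using C a0 by (intro divide_left_mono) auto
    then show "k \<le> 1/400" "k \<le> 1" using a0 by auto
  qed
  define \<delta> where "\<delta> = k ^ 4 / v ^ 20"
  have d0: "\<delta> > 0" "\<delta> \<le> 1/400"
  proof -
    show "\<delta> > 0" using k0 v1 by (simp add: \<delta>_def)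
    have "\<delta> \<le> k ^ 4 / 1" unfolding \<delta>_def using v1 k0 by (intro divide_left_mono) auto
    also have "\<dots> \<le> k ^ 1 / 1" using k0 by (intro divide_right_mono power_decreasing) auto
    finally show "\<delta> \<le> 1/400" using k0 by simp
  qed
  have far: "cmod (zeta_reg (Complex \<sigma> t)) \<ge> a * k ^ 3 * \<tau> / v ^ 16" if \<sigma>: "1 + \<delta> \<le> \<sigma>" "\<sigma> \<le> 2" for \<sigma>
  proof -
    have "\<tau> ^ 5 * (k ^ 12 / v ^ 60) \<le> (4 * \<bar>t\<bar>) ^ 5 * (\<sigma> - 1) ^ 3"
    proof (intro mult_mono power_mono)
      have "k ^ 12 / v ^ 60 = \<delta> ^ 3" by (simp add: \<delta>_def power_divide flip: power_mult)
      also have "\<dots> \<le> (\<sigma> - 1) ^ 3" using \<sigma> d0 by (intro power_mono) auto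
      finally show "k ^ 12 / v ^ 60 \<le> (\<sigma> - 1) ^ 3" .
    qed (use tau k0 v1 in auto)
    also have "\<dots> = 1024 * ((\<sigma> - 1) ^ 3 * \<bar>t\<bar> ^ 5)"
      by (simp add: power_mult_distrib)
    also have "\<dots> \<le> 1024 * (2916 * C ^ 4 * \<tau> * v ^ 4 * cmod (zeta_reg (Complex \<sigma> t)) ^ 4)"
      using zeta_reg_341[OF C bd, of \<sigma> t] \<sigma> d0 v4 unfolding tau(1)
      by (intro mult_left_mono) auto
    also have "\<dots> \<le> 100 ^ 4 * C ^ 4 * \<tau> * v ^ 4 * cmod (zeta_reg (Complex \<sigma> t)) ^ 4"
      using C tau v1 by simp
    finally have "\<tau> ^ 4 * (k ^ 12 / v ^ 60) * \<tau> \<le> (100 ^ 4 * C ^ 4 * v ^ 4 * cmod (zeta_reg (Complex \<sigma> t)) ^ 4) * \<tau>"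
      by (simp add: power_numeral_reduce mult_ac)
    then have "\<tau> ^ 4 * (k ^ 12 / v ^ 60) \<le> 100 ^ 4 * C ^ 4 * v ^ 4 * cmod (zeta_reg (Complex \<sigma> t)) ^ 4"
      by (rule mult_right_le_imp_le) (use tau in auto)
    then have "\<tau> ^ 4 * (k ^ 12 / v ^ 60) / (100 ^ 4 * C ^ 4 * v ^ 4) \<le> cmod (zeta_reg (Complex \<sigma> t)) ^ 4"
      using C v1 by (simp add: pos_divide_le_eq mult_ac)
    also have "\<tau> ^ 4 * (k ^ 12 / v ^ 60) / (100 ^ 4 * C ^ 4 * v ^ 4) = (a * k ^ 3 * \<tau> / v ^ 16) ^ 4"
    proof -
      have "(a * k ^ 3 * \<tau> / v ^ 16) ^ 4 = a ^ 4 * k ^ 12 * \<tau> ^ 4 / v ^ 64"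
        by (simp add: power_mult_distrib power_divide flip: power_mult)
      also have "a ^ 4 = 1 / (100 ^ 4 * C ^ 4)"
        by (simp add: a power_divide power_mult_distrib)
      also have "v ^ 64 = v ^ 60 * v ^ 4" by (simp flip: power_add)
      finally show ?thesis by (simp only: divide_divide_eq_left times_divide_eq_right times_divide_eq_left mult_1_left) (simp only: mult_ac)
    qed
    finally show ?thesis by (rule power_le_imp_le_base[of _ 3, simplified]) auto
  qed
  have seq: "s = Complex (Re s) t" by (simp add: t_def)
  have half: "a * k ^ 3 * \<tau> / v ^ 16 \<ge> a * k ^ 3 * \<tau> / v ^ 16 / 2"
  proof -
    have "0 \<le> a * k ^ 3 * \<tau> / v ^ 16"
      using a0 k0 tau v1 by (intro divide_nonneg_nonneg mult_nonneg_nonneg zero_le_power) auto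
    moreover have "x / 2 \<le> x" if "x \<ge> 0" for x :: real using that by simp
    ultimately show ?thesis by blast
  qed
  have "cmod (zeta_reg s) \<ge> a * k ^ 3 * \<tau> / v ^ 16 / 2"
  proof (cases "Re s \<ge> 1 + \<delta>")
    case True
    then show ?thesis using far[of "Re s"] half seq s by simp
  next
    case False
    have s1: "1 - \<delta> \<le> Re s" using s vp by (simp add: \<delta>_def)
    have "cmod (zeta_reg (Complex (1 + \<delta>) t) - zeta_reg (Complex (Re s) t)) \<le> C * \<tau> * v ^ 4 * (1 + \<delta> - Re s)"
      using zeta_reg_diff_bound[OF bd', of "Re s" "1 + \<delta>" t] False s1 d0 tau v4 by simp
    also have "\<dots> \<le> C * \<tau> * v ^ 4 * (2 * \<delta>)"
      using s1 C tau v1 by (intro mult_left_mono) auto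
    also have "\<dots> = (2 * C * k) * k ^ 3 * \<tau> / v ^ 16"
    proof -
      have "v ^ 4 / v ^ 20 = 1 / v ^ 16" using v1 by (simp add: field_simps flip: power_add)
      then show ?thesis by (simp add: \<delta>_def power_numeral_reduce field_simps)
    qed
    also have "2 * C * k = a / 2" using C by (simp add: k)
    finally have "cmod (zeta_reg (Complex (1 + \<delta>) t) - zeta_reg s) \<le> a * k ^ 3 * \<tau> / v ^ 16 / 2"
      using seq by simp
    moreover have "cmod (zeta_reg (Complex (1 + \<delta>) t)) \<ge> a * k ^ 3 * \<tau> / v ^ 16"
      using far d0 by simp
    ultimately show ?thesis
      using norm_triangle_sub[of "zeta_reg (Complex (1 + \<delta>) t)" "zeta_reg s"] by linarith
  qed
  then show ?thesis using vp tau by (simp add: mult_ac)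
qed


text \<open>
  On the line \<open>Re s = 1\<close>, a zero at \<open>1 + t \<i>\<close> would make the fourth power of \<open>zeta_reg (1 + e + t \<i>)\<close> of
  order \<open>e ^ 4\<close>, against the lower bound of order \<open>e ^ 3\<close>.
\<close>
lemma zeta_reg_nonzero:
  assumes "1 \<le> Re s" "Re s \<le> 2"
  shows "zeta_reg s \<noteq> 0"
proof (cases "Re s > 1")
  case True
  have "zeta_series s \<noteq> 0"
    using zeta_series_341[OF True, of "Im s"] by auto
  moreover have "zeta_reg s = (s - 1) * zeta_series s"
    using zeta_reg_eq[OF True] by (simp add: zeta_series_def)
  moreover have "s \<noteq> 1" using True by auto
  ultimately show ?thesis by simp
next
  case False
  define t where "t = Im s"
  have s: "s = Complex 1 t" using False assms by (simp add: t_def complex_eq_iff)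
  show ?thesis
  proof (cases "t = 0")
    case True
    then show ?thesis by (simp add: s flip: one_complex.code)
  next
    case False
    show ?thesis
    proof
      assume zero: "zeta_reg s = 0"
      obtain C where C: "C \<ge> 1"
        and bd: "\<And>s. 159/160 \<le> Re s \<Longrightarrow> Re s \<le> 2 \<Longrightarrow> cmod (zeta_reg s) \<le> C * height s * height s powr (1/40)"
        and bd': "\<And>s. 159/160 \<le> Re s \<Longrightarrow> Re s \<le> 2 \<Longrightarrow> cmod (deriv zeta_reg s) \<le> C * height s * height s powr (1/40)"
        using zeta_reg_bounds by blast
      define A where "A = 2916 * C ^ 4 * (\<bar>t\<bar> + 3) * (\<bar>t\<bar> + 3) powr (1/40)"
      define B where "B = C * (\<bar>t\<bar> + 3) * (\<bar>t\<bar> + 3) powr (1/40)"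
      have AB: "A > 0" "B > 0" using C by (auto simp: A_def B_def)
      \<comment> \<open>so small that \<open>A * B ^ 4 * e\<close> is at most half of \<open>\<bar>t\<bar> ^ 5\<close>\<close>
      define e where "e = min 1 (\<bar>t\<bar> ^ 5 / (2 * A * B ^ 4))"
      have e: "e > 0" "e \<le> 1" using AB False by (auto simp: e_def)
      have "cmod (zeta_reg (Complex (1 + e) t)) \<le> B * e"
        using zeta_reg_diff_bound[OF bd', of 1 "1 + e" t] e zero s by (simp add: B_def)
      then have "cmod (zeta_reg (Complex (1 + e) t)) ^ 4 \<le> (B * e) ^ 4"
        by (rule power_mono) auto
      then have "A * cmod (zeta_reg (Complex (1 + e) t)) ^ 4 \<le> A * (B * e) ^ 4"
        using AB by (intro mult_left_mono) auto
      moreover have "e ^ 3 * \<bar>t\<bar> ^ 5 \<le> A * cmod (zeta_reg (Complex (1 + e) t)) ^ 4"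
        using zeta_reg_341[OF C bd, of "1 + e" t] e by (simp add: A_def)
      ultimately have "e ^ 3 * \<bar>t\<bar> ^ 5 \<le> A * (B * e) ^ 4" by linarith
      also have "\<dots> = e ^ 3 * (A * B ^ 4 * e)"
        by (simp add: power_mult_distrib power_numeral_reduce)
      finally have "\<bar>t\<bar> ^ 5 \<le> A * B ^ 4 * e"
        using e by simp
      also have "\<dots> \<le> A * B ^ 4 * (\<bar>t\<bar> ^ 5 / (2 * A * B ^ 4))"
        using AB by (intro mult_left_mono) (auto simp: e_def)
      also have "\<dots> = \<bar>t\<bar> ^ 5 / 2" using AB by simp
      finally show False using False by simp
    qed
  qed
qed

text \<open>
  Heights above 1 are covered by \<open>zeta_reg_lower_bound\<close>. Near the real axis, where that
  bound degenerates, nonvanishing on a compact rectangle gives a positive minimum, which the bounded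
  derivative extends slightly to the left of the line \<open>Re s = 1\<close>.
\<close>
lemma zero_free_region:
  obtains c M where "0 < c" "c \<le> 1/160" "M \<ge> 1"
    "\<And>T s. T \<ge> 1 \<Longrightarrow> \<bar>Im s\<bar> \<le> T \<Longrightarrow> 1 - c / T powr (1/8) \<le> Re s \<Longrightarrow> Re s \<le> 2 \<Longrightarrow>
       zeta_reg s \<noteq> 0 \<and> cmod (deriv zeta_reg s / zeta_reg s) \<le> M * T powr (1/8)"
proof -
  obtain C where C: "C \<ge> 1"
    and bd: "\<And>s. 159/160 \<le> Re s \<Longrightarrow> Re s \<le> 2 \<Longrightarrow> cmod (zeta_reg s) \<le> C * height s * height s powr (1/40)"
    and bd': "\<And>s. 159/160 \<le> Re s \<Longrightarrow> Re s \<le> 2 \<Longrightarrow> cmod (deriv zeta_reg s) \<le> C * height s * height s powr (1/40)"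
    using zeta_reg_bounds by blast
  define a where "a = 1 / (100 * C)"
  define k where "k = a / (4 * C)"
  have a0: "a > 0" "a \<le> 1/100" using C by (auto simp: a_def field_simps)
  have k0: "k > 0" "k \<le> 1/400"
  proof -
    show "k > 0" using a0 C by (simp add: k_def)
    have "k \<le> a / 4" unfolding k_def using C a0 by (intro divide_left_mono) auto
    then show "k \<le> 1/400" using a0 by auto
  qed
  have k4: "k ^ 4 \<le> 1 / 400"
    using power_decreasing[of 1 4 k] k0 by simp
  have four: "4 powr (1/8) \<le> (2 :: real)"
  proof -
    have "4 powr (1/8) \<le> (4 powr (1/2) :: real)" by (rule powr_mono) auto
    also have "\<dots> = 2" by (simp add: powr_half_sqrt)
    finally show ?thesis .
  qed
  define K where "K = cbox (Complex 1 (-1)) (Complex 2 1)"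
  have K: "s \<in> K \<longleftrightarrow> 1 \<le> Re s \<and> Re s \<le> 2 \<and> \<bar>Im s\<bar> \<le> 1" for s
    by (auto simp: K_def in_cbox_complex_iff)
  have "continuous_on K (\<lambda>s. cmod (zeta_reg s))"
    by (intro continuous_on_norm continuous_on_subset[OF holomorphic_on_imp_continuous_on[OF holomorphic_zeta_reg]])
       (auto simp: K)
  moreover have "compact K" "K \<noteq> {}" unfolding K_def by (auto simp: complex_eq_iff box_ne_empty Basis_complex_def)
  ultimately obtain s0 where s0: "s0 \<in> K" "\<And>s. s \<in> K \<Longrightarrow> cmod (zeta_reg s0) \<le> cmod (zeta_reg s)"
    using continuous_attains_inf[of K "\<lambda>s. cmod (zeta_reg s)"] by blast
  define m where "m = cmod (zeta_reg s0)"
  have m: "m > 0" using s0 zeta_reg_nonzero[of s0] by (auto simp: m_def K)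
  define c1 where "c1 = min (1/160) (m / (32 * C))"
  have c1: "c1 > 0" "c1 \<le> 1/160" "c1 \<le> m / (32 * C)" using m C by (auto simp: c1_def)
  have small: "C * (\<bar>t\<bar> + 3) * (\<bar>t\<bar> + 3) powr (1/40) \<le> 16 * C" if "\<bar>t\<bar> \<le> 1" for t :: real
  proof -
    have "(\<bar>t\<bar> + 3) powr (1/40) \<le> (\<bar>t\<bar> + 3) powr 1" by (rule powr_mono) auto
    then have "C * (\<bar>t\<bar> + 3) * (\<bar>t\<bar> + 3) powr (1/40) \<le> C * 4 * 4"
      using that C by (intro mult_mono) auto
    then show ?thesis by simp
  qed
  have low: "cmod (zeta_reg s) \<ge> m / 2" if s: "\<bar>Im s\<bar> \<le> 1" "1 - c1 \<le> Re s" "Re s \<le> 2" for s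
  proof (cases "Re s \<ge> 1")
    case True
    then show ?thesis using s0(2)[of s] s m by (simp add: m_def[symmetric] K)
  next
    case False
    define t where "t = Im s"
    have seq: "s = Complex (Re s) t" by (simp add: t_def)
    have "cmod (zeta_reg (Complex 1 t) - zeta_reg s) \<le> C * (\<bar>t\<bar> + 3) * (\<bar>t\<bar> + 3) powr (1/40) * (1 - Re s)"
      using zeta_reg_diff_bound[OF bd', of "Re s" 1 t] False s c1 seq by simp
    also have "\<dots> \<le> 16 * C * (m / (32 * C))"
      by (rule mult_mono) (use small[of t] s c1 False C in \<open>auto simp: t_def\<close>)
    also have "\<dots> = m / 2" using C by simp
    finally have "cmod (zeta_reg (Complex 1 t) - zeta_reg s) \<le> m / 2" .
    moreover have "cmod (zeta_reg (Complex 1 t)) \<ge> m"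
      using s0(2)[of "Complex 1 t"] s by (simp add: m_def K t_def)
    ultimately show ?thesis
      using norm_triangle_sub[of "zeta_reg (Complex 1 t)" "zeta_reg s"] by linarith
  qed
  define c where "c = min c1 (k ^ 4 / 2)"
  define M where "M = max C (max (32 * C / m) (4 * C / (a * k ^ 3)))"
  have M1: "M \<ge> 1" "M \<ge> C" using C by (auto simp: M_def)
  have c: "c > 0" "c \<le> 1/160" "c \<le> c1" "c \<le> k ^ 4 / 2" using c1 k0 by (auto simp: c_def)
  show ?thesis
  proof (rule that[of c M])
    fix T s
    assume T: "T \<ge> (1::real)" and s: "\<bar>Im s\<bar> \<le> T" "1 - c / T powr (1/8) \<le> Re s" "Re s \<le> 2"
    have T1: "T powr (1/8) \<ge> 1" using T by (intro ge_one_powr_ge_zero) auto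
    have "c / T powr (1/8) \<le> c / 1" using c T1 by (intro divide_left_mono) auto
    then have cT: "c / T powr (1/8) \<le> c" by simp
    have Re: "159/160 \<le> Re s" using s cT c by linarith
    show "zeta_reg s \<noteq> 0 \<and> cmod (deriv zeta_reg s / zeta_reg s) \<le> M * T powr (1/8)"
    proof (cases "\<bar>Im s\<bar> \<le> 1")
      case True
      have 1: "cmod (zeta_reg s) \<ge> m / 2" using True s cT c by (intro low) auto
      have "cmod (deriv zeta_reg s) \<le> 16 * C"
        using bd'[OF Re s(3)] small[OF True] by (simp add: height_def)
      then have "cmod (deriv zeta_reg s) / cmod (zeta_reg s) \<le> 16 * C / (m / 2)"
        using 1 m C by (intro frac_le) auto
      also have "\<dots> \<le> M * 1" by (simp add: M_def)
      also have "\<dots> \<le> M * T powr (1/8)" using M1 T1 by (intro mult_left_mono) auto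
      finally show ?thesis using 1 m by (auto simp: norm_divide)
    next
      case False
      define \<tau> where "\<tau> = height s"
      have tau: "\<tau> \<ge> 3" "\<tau> \<le> 4 * T" using False s height_ge_3[of s] by (auto simp: \<tau>_def height_def)
      have "\<tau> powr (1/8) \<le> (4 * T) powr (1/8)" using tau by (intro powr_mono2) auto
      also have "\<dots> = 4 powr (1/8) * T powr (1/8)" by (rule powr_mult)
      also have "\<dots> \<le> 2 * T powr (1/8)" using four by (intro mult_right_mono) auto
      finally have t8: "\<tau> powr (1/8) \<le> 2 * T powr (1/8)" .
      have "c / T powr (1/8) \<le> k ^ 4 / 2 / T powr (1/8)" using c by (intro divide_right_mono) auto
      also have "\<dots> = k ^ 4 / (2 * T powr (1/8))" by simp
      also have "\<dots> \<le> k ^ 4 / \<tau> powr (1/8)" using t8 tau T1 k0 by (intro divide_left_mono mult_pos_pos) auto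
      finally have "1 - k ^ 4 / height s powr (1/8) \<le> Re s" using s by (simp add: \<tau>_def)
      then have low': "a * k ^ 3 / 2 * \<tau> / \<tau> powr (1/10) \<le> cmod (zeta_reg s)"
        unfolding \<tau>_def using False s
        by (intro zeta_reg_lower_bound[OF C bd bd' a_def k_def]) auto
      have pos: "0 < a * k ^ 3 / 2 * \<tau> / \<tau> powr (1/10)"
        using a0 k0 tau by simp
      have "cmod (deriv zeta_reg s) / cmod (zeta_reg s) \<le> (C * \<tau> * \<tau> powr (1/40)) / (a * k ^ 3 / 2 * \<tau> / \<tau> powr (1/10))"
        using low' pos bd'[OF Re s(3)] C tau by (intro frac_le) (auto simp: \<tau>_def)
      also have "\<dots> = 2 * C / (a * k ^ 3) * (\<tau> powr (1/40) * \<tau> powr (1/10))"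
        using tau a0 k0 by (simp add: field_simps)
      also have "\<tau> powr (1/40) * \<tau> powr (1/10) = \<tau> powr (1/8)"
        by (simp flip: powr_add)
      also have "2 * C / (a * k ^ 3) * \<tau> powr (1/8) \<le> 2 * C / (a * k ^ 3) * (2 * T powr (1/8))"
        using t8 C a0 k0 by (intro mult_left_mono) auto
      also have "\<dots> = 4 * C / (a * k ^ 3) * T powr (1/8)" by simp
      also have "\<dots> \<le> M * T powr (1/8)"
        by (intro mult_right_mono) (auto simp: M_def)
      finally show ?thesis using low' pos by (auto simp: norm_divide)
    qed
  qed (use c M1 in auto)
qed

section \<open>The truncated Perron kernel\<close>

lemma contour_integral_rectpath:
  fixes a b T :: real
  defines "p \<equiv> Complex a (-T)" and "q \<equiv> Complex b T"
  assumes "a \<le> b" "0 \<le> T" and cont: "continuous_on (path_image (rectpath p q)) f"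
  shows "contour_integral (rectpath p q) f =
      contour_integral (linepath (Complex a (-T)) (Complex b (-T))) f
    + contour_integral (linepath (Complex b (-T)) (Complex b T)) f
    - contour_integral (linepath (Complex a T) (Complex b T)) f
    - contour_integral (linepath (Complex a (-T)) (Complex a T)) f"
proof -
  define r where "r = Complex b (-T)"
  define s where "s = Complex a T"
  have rect: "rectpath p q = linepath p r +++ linepath r q +++ linepath q s +++ linepath s p"
    by (simp add: rectpath_def Let_def p_def q_def r_def s_def)
  have im: "path_image (rectpath p q) = closed_segment p r \<union> closed_segment r q \<union> closed_segment q s \<union> closed_segment s p"
    unfolding rect by (simp add: path_image_join Un_assoc)
  have ci: "f contour_integrable_on linepath u v" if "closed_segment u v \<subseteq> path_image (rectpath p q)" for u v
    using that cont continuous_on_subset by (intro contour_integrable_continuous_linepath) blast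
  have i: "f contour_integrable_on linepath p r" "f contour_integrable_on linepath r q"
    "f contour_integrable_on linepath q s" "f contour_integrable_on linepath s p"
    by (rule ci; use im in blast)+
  have rev: "contour_integral (linepath u v) f = - contour_integral (linepath v u) f" for u v
    using contour_integral_reversepath[of "linepath v u" f] by simp
  have "contour_integral (rectpath p q) f = contour_integral (linepath p r) f + (contour_integral (linepath r q) f
     + (contour_integral (linepath q s) f + contour_integral (linepath s p) f))"
    unfolding rect using i by (simp add: contour_integrable_joinI)
  also have "contour_integral (linepath q s) f = - contour_integral (linepath s q) f" by (rule rev)
  also have "contour_integral (linepath s p) f = - contour_integral (linepath p s) f" by (rule rev)
  finally show ?thesis by (simp add: p_def q_def r_def s_def)
qed

text \<open>
  Here \<open>I\<close> stands for the contribution of the enclosed poles; apart from it, the integrals over the two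
  vertical sides differ by those over the horizontal ones.
\<close>
lemma contour_integral_vertical_shift:
  fixes a b T :: real
  assumes ab: "a \<le> b" "0 \<le> T" and hol: "continuous_on (path_image (rectpath (Complex a (-T)) (Complex b T))) f"
    and I: "(f has_contour_integral I) (rectpath (Complex a (-T)) (Complex b T))"
    and B: "\<And>s. a \<le> Re s \<Longrightarrow> Re s \<le> b \<Longrightarrow> \<bar>Im s\<bar> = T \<Longrightarrow> cmod (f s) \<le> B"
  shows "cmod (contour_integral (linepath (Complex b (-T)) (Complex b T)) f
             - contour_integral (linepath (Complex a (-T)) (Complex a T)) f - I) \<le> 2 * (b - a) * B"
proof -
  have B0: "B \<ge> 0" using order_trans[OF norm_ge_zero B[of "Complex a T"]] ab by simp
  have im: "closed_segment (Complex a u) (Complex b u) \<subseteq> path_image (rectpath (Complex a (-T)) (Complex b T))"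
    if "u = T \<or> u = -T" for u
    using that by (auto simp: rectpath_def Let_def path_image_join closed_segment_commute)
  have h: "cmod (contour_integral (linepath (Complex a u) (Complex b u)) f) \<le> B * (b - a)" if "u = T \<or> u = -T" for u
  proof -
    have "cmod (contour_integral (linepath (Complex a u) (Complex b u)) f) \<le> B * cmod (Complex b u - Complex a u)"
    proof (rule contour_integral_bound_linepath)
      show "f contour_integrable_on linepath (Complex a u) (Complex b u)"
        using im[OF that] hol continuous_on_subset by (intro contour_integrable_continuous_linepath) blast
      show "cmod (f s) \<le> B" if "s \<in> closed_segment (Complex a u) (Complex b u)" for s
        using that \<open>u = T \<or> u = -T\<close> ab
        by (intro B) (auto simp: closed_segment_same_Im closed_segment_eq_real_ivl)
    qed (use B0 in auto)
    also have "cmod (Complex b u - Complex a u) = b - a" using ab by (simp add: cmod_def)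
    finally show ?thesis .
  qed
  have "contour_integral (linepath (Complex b (-T)) (Complex b T)) f
             - contour_integral (linepath (Complex a (-T)) (Complex a T)) f - I =
        contour_integral (linepath (Complex a T) (Complex b T)) f - contour_integral (linepath (Complex a (-T)) (Complex b (-T))) f"
    using contour_integral_rectpath[OF ab hol] contour_integral_unique[OF I] by (simp add: algebra_simps)
  also have "cmod \<dots> \<le> B * (b - a) + B * (b - a)"
    using norm_triangle_ineq4 h[of T] h[of "-T"] by (smt (verit))
  finally show ?thesis by (simp add: algebra_simps)
qed

lemma contour_integral_vertical_bound:
  fixes a T :: real
  assumes "0 \<le> T" "continuous_on {s. Re s = a \<and> \<bar>Im s\<bar> \<le> T} f"
    and B: "\<And>s. Re s = a \<Longrightarrow> \<bar>Im s\<bar> \<le> T \<Longrightarrow> cmod (f s) \<le> B"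
  shows "cmod (contour_integral (linepath (Complex a (-T)) (Complex a T)) f) \<le> 2 * T * B"
proof -
  have seg: "closed_segment (Complex a (-T)) (Complex a T) \<subseteq> {s. Re s = a \<and> \<bar>Im s\<bar> \<le> T}"
    using assms(1) by (auto simp: closed_segment_same_Re closed_segment_eq_real_ivl)
  have "cmod (contour_integral (linepath (Complex a (-T)) (Complex a T)) f) \<le> B * cmod (Complex a T - Complex a (-T))"
  proof (rule contour_integral_bound_linepath)
    show "f contour_integrable_on linepath (Complex a (-T)) (Complex a T)"
      using seg assms(2) continuous_on_subset by (intro contour_integrable_continuous_linepath) blast
    show "0 \<le> B" using order_trans[OF norm_ge_zero B[of "Complex a 0"]] assms(1) by simp
  qed (use seg B in auto)
  also have "cmod (Complex a T - Complex a (-T)) = 2 * T" using assms(1) by (simp add: cmod_def real_sqrt_mult)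
  finally show ?thesis by (simp add: mult_ac)
qed

lemma norm_of_real_powr: "y > 0 \<Longrightarrow> cmod (of_real y powr s) = y powr Re s"
  using norm_powr_real_powr[of "of_real y" s] by simp

lemma perron_kernel_bound:
  assumes "y > 0" "T > 0" "cmod s \<ge> T" "cmod (s + 1) \<ge> T" "y powr Re s \<le> y powr c"
  shows "cmod (of_real y powr s / (s * (s + 1))) \<le> y powr c / T\<^sup>2"
proof -
  have "cmod (of_real y powr s / (s * (s + 1))) = y powr Re s / (cmod s * cmod (s + 1))"
    using assms by (simp add: norm_divide norm_mult norm_of_real_powr)
  also have "\<dots> \<le> y powr c / (T * T)"
    using assms by (intro frac_le mult_mono mult_pos_pos) auto
  finally show ?thesis by (simp add: power2_eq_square)
qed

text \<open>
  For \<open>y \<le> 1\<close> the integrand is small to the right of the line and the contour is closed there, around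
  no pole. For \<open>y > 1\<close> it is closed on the left, around the poles 0 and -1, whose residues add up to
  \<open>1 - 1 / y\<close>. The kernel decays quadratically, so the other three sides, of length at most a multiple
  of \<open>T\<close>, contribute only \<open>O(y powr c / T)\<close>.
\<close>
lemma perron_kernel:
  fixes y c T :: real
  assumes y: "y > 0" and c: "0 < c" "c \<le> 2" and T: "T \<ge> 3"
  shows "cmod (contour_integral (linepath (Complex c (-T)) (Complex c T)) (\<lambda>s. of_real y powr s / (s * (s + 1)))
            - 2 * pi * \<i> * of_real (max 0 (1 - 1 / y))) \<le> 6 * y powr c / T"
proof -
  define f where "f = (\<lambda>s :: complex. of_real y powr s / (s * (s + 1)))"
  define B where "B = y powr c / T\<^sup>2"
  have B0: "B \<ge> 0" by (simp add: B_def)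
  have BT: "T * B = y powr c / T" using T by (simp add: B_def power2_eq_square)
  have y0: "complex_of_real y \<noteq> 0" using y by simp
  have cont: "continuous_on A f" if "0 \<notin> A" "-1 \<notin> A" for A
    unfolding f_def
    by (rule holomorphic_on_imp_continuous_on, intro holomorphic_intros)
       (use that y0 in \<open>auto simp: add_eq_0_iff2\<close>)
  have big: "cmod s \<ge> T \<and> cmod (s + 1) \<ge> T" if "\<bar>Im s\<bar> = T" for s
    using that abs_Im_le_cmod[of s] abs_Im_le_cmod[of "s + 1"] by auto
  show ?thesis
  proof (cases "y \<le> 1")
    case True
    have le: "y powr Re s \<le> y powr c" if "c \<le> Re s" for s
      using that True y by (intro powr_mono') auto
    let ?p = "Complex c (-T)" and ?q = "Complex (c + T) T"
    have sub: "path_image (rectpath ?p ?q) \<subseteq> cbox ?p ?q"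
      using T by (intro path_image_rectpath_subset_cbox) auto
    have pos: "Re s \<ge> c" if "s \<in> cbox ?p ?q" for s
      using that by (auto simp: in_cbox_complex_iff)
    have hol: "f holomorphic_on cbox ?p ?q"
      unfolding f_def using c y0
      by (intro holomorphic_intros) (auto simp: add_eq_0_iff2 dest!: pos)
    have I: "(f has_contour_integral 0) (rectpath ?p ?q)"
      by (rule Cauchy_theorem_convex_simple[OF hol]) (use sub in auto)
    have "cmod (contour_integral (linepath (Complex (c + T) (-T)) (Complex (c + T) T)) f
             - contour_integral (linepath (Complex c (-T)) (Complex c T)) f - 0) \<le> 2 * (c + T - c) * B"
    proof (rule contour_integral_vertical_shift[OF _ _ _ I])
      show "continuous_on (path_image (rectpath ?p ?q)) f"
        using holomorphic_on_imp_continuous_on[OF hol] sub continuous_on_subset by blast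
      show "cmod (f s) \<le> B" if "c \<le> Re s" "\<bar>Im s\<bar> = T" for s
        unfolding f_def B_def using y T big[OF that(2)] le[OF that(1)] by (intro perron_kernel_bound) auto
    qed (use T in auto)
    moreover have "cmod (contour_integral (linepath (Complex (c + T) (-T)) (Complex (c + T) T)) f) \<le> 2 * T * B"
    proof (rule contour_integral_vertical_bound)
      show "continuous_on {s. Re s = c + T \<and> \<bar>Im s\<bar> \<le> T} f" using c T by (intro cont) auto
      show "cmod (f s) \<le> B" if "Re s = c + T" for s
        unfolding f_def B_def using y T c that le[of s] complex_Re_le_cmod[of s] complex_Re_le_cmod[of "s + 1"]
        by (intro perron_kernel_bound) auto
    qed (use T in auto)
    ultimately have "cmod (contour_integral (linepath (Complex c (-T)) (Complex c T)) f) \<le> 4 * (T * B)"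
      using norm_triangle_ineq2[of "contour_integral (linepath (Complex c (-T)) (Complex c T)) f"
            "contour_integral (linepath (Complex (c + T) (-T)) (Complex (c + T) T)) f"]
      by (simp add: norm_minus_commute)
    also have "\<dots> \<le> 6 * (T * B)" using T B0 by simp
    finally have "cmod (contour_integral (linepath (Complex c (-T)) (Complex c T)) f) \<le> 6 * y powr c / T"
      unfolding BT by simp
    moreover have "max 0 (1 - 1 / y) = 0" using True y by simp
    ultimately show ?thesis by (simp add: f_def)
  next
    case False
    then have y1: "y > 1" by simp
    have le: "y powr Re s \<le> y powr c" if "Re s \<le> c" for s
      using that y1 by (intro powr_mono) auto
    let ?p = "Complex (-T-1) (-T)" and ?q = "Complex c T"
    have box: "z \<in> box ?p ?q" if "z = 0 \<or> z = -1" for z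
      using that T c by (auto simp: in_box_complex_iff)
    have sub: "path_image (rectpath ?p ?q) \<subseteq> cbox ?p ?q - {z}" if "z = 0 \<or> z = -1" for z
    proof -
      have "path_image (rectpath ?p ?q) \<subseteq> cbox ?p ?q" using T c by (intro path_image_rectpath_subset_cbox) auto
      moreover have "path_image (rectpath ?p ?q) \<inter> box ?p ?q = {}"
        using T c by (intro path_image_rectpath_inter_box) auto
      ultimately show ?thesis using box[OF that] by blast
    qed
    have hol: "(\<lambda>s. of_real y powr s) holomorphic_on cbox ?p ?q"
      using y0 by (intro holomorphic_intros)
    have C: "((\<lambda>s. of_real y powr s / (s - z)) has_contour_integral 2 * pi * \<i> * of_real y powr z) (rectpath ?p ?q)"
      if "z = 0 \<or> z = -1" for z
    proof -
      have "((\<lambda>s. of_real y powr s / (s - z)) has_contour_integral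
          (2 * pi * \<i> * winding_number (rectpath ?p ?q) z * of_real y powr z)) (rectpath ?p ?q)"
        by (rule Cauchy_integral_formula_convex_simple[OF _ hol])
           (use sub[OF that] box[OF that] in \<open>auto simp: interior_cbox\<close>)
      also have "winding_number (rectpath ?p ?q) z = 1"
        by (rule winding_number_rectpath[OF box[OF that]])
      finally show ?thesis by simp
    qed
    have y1i: "of_real y powr (-1 :: complex) = of_real (1 / y)"
      using y0 by (simp add: powr_minus inverse_eq_divide)
    have "((\<lambda>s. of_real y powr s / (s - 0) - of_real y powr s / (s - (-1))) has_contour_integral
         (2 * pi * \<i> * of_real y powr 0 - 2 * pi * \<i> * of_real y powr (-1))) (rectpath ?p ?q)"
      by (intro has_contour_integral_diff C) auto
    then have "(f has_contour_integral (2 * pi * \<i> * of_real y powr 0 - 2 * pi * \<i> * of_real y powr (-1))) (rectpath ?p ?q)"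
    proof (rule has_contour_integral_eq)
      fix s assume "s \<in> path_image (rectpath ?p ?q)"
      then have "s \<noteq> 0" "s + 1 \<noteq> 0" using sub[of 0] sub[of "-1"] by (auto simp: add_eq_0_iff2)
      then show "of_real y powr s / (s - 0) - of_real y powr s / (s - (-1)) = f s"
        by (simp add: f_def field_simps)
    qed
    also have "2 * pi * \<i> * of_real y powr 0 - 2 * pi * \<i> * of_real y powr (-1) = 2 * pi * \<i> * of_real (max 0 (1 - 1 / y))"
      using y0 y1 unfolding y1i by (simp add: algebra_simps)
    finally have I: "(f has_contour_integral 2 * pi * \<i> * of_real (max 0 (1 - 1 / y))) (rectpath ?p ?q)" .
    have "cmod (contour_integral (linepath (Complex c (-T)) (Complex c T)) f
             - contour_integral (linepath (Complex (-T-1) (-T)) (Complex (-T-1) T)) f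
             - 2 * pi * \<i> * of_real (max 0 (1 - 1 / y))) \<le> 2 * (c - (-T-1)) * B"
    proof (rule contour_integral_vertical_shift[OF _ _ _ I])
      show "continuous_on (path_image (rectpath ?p ?q)) f"
        by (rule cont) (use sub[of 0] sub[of "-1"] in auto)
      show "cmod (f s) \<le> B" if "Re s \<le> c" "\<bar>Im s\<bar> = T" for s
        unfolding f_def B_def using y T big[OF that(2)] le[OF that(1)] by (intro perron_kernel_bound) auto
    qed (use T c in auto)
    also have "\<dots> \<le> 2 * (2 * T) * B" using T c B0 by (intro mult_right_mono) auto
    finally have 1: "cmod (contour_integral (linepath (Complex c (-T)) (Complex c T)) f
             - contour_integral (linepath (Complex (-T-1) (-T)) (Complex (-T-1) T)) f
             - 2 * pi * \<i> * of_real (max 0 (1 - 1 / y))) \<le> 4 * (T * B)" by simp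
    have "cmod (contour_integral (linepath (Complex (-T-1) (-T)) (Complex (-T-1) T)) f) \<le> 2 * T * B"
    proof (rule contour_integral_vertical_bound)
      show "continuous_on {s. Re s = -T-1 \<and> \<bar>Im s\<bar> \<le> T} f" using T by (intro cont) auto
      show "cmod (f s) \<le> B" if "Re s = -T-1" for s
        unfolding f_def B_def using y T c that le[of s] abs_Re_le_cmod[of s] abs_Re_le_cmod[of "s + 1"]
        by (intro perron_kernel_bound) auto
    qed (use T in auto)
    with 1 have "cmod (contour_integral (linepath (Complex c (-T)) (Complex c T)) f - 2 * pi * \<i> * of_real (max 0 (1 - 1 / y))) \<le> 6 * (T * B)"
      using norm_triangle_ineq[of "contour_integral (linepath (Complex c (-T)) (Complex c T)) f
             - contour_integral (linepath (Complex (-T-1) (-T)) (Complex (-T-1) T)) f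
             - 2 * pi * \<i> * of_real (max 0 (1 - 1 / y))" "contour_integral (linepath (Complex (-T-1) (-T)) (Complex (-T-1) T)) f"]
      by simp
    then show ?thesis unfolding BT f_def by simp
  qed
qed

section \<open>The Dirichlet series of \<open>\<Lambda> - 1\<close>\<close>

text \<open>The coefficients of \<open>- \<zeta>' / \<zeta> - \<zeta>\<close>; the value at 0 is set to 0 as Dirichlet series start at \<open>n = 1\<close>.\<close>
definition err_coeff :: "nat \<Rightarrow> real" where
  "err_coeff n = (if n = 0 then 0 else mangoldt n - 1)"

definition smoothed_err :: "real \<Rightarrow> real" where
  "smoothed_err X = (\<Sum>n | 1 \<le> n \<and> real n \<le> X. err_coeff n * (1 - real n / X))"

lemma summable_err_coeff:
  assumes "\<sigma> > 1"
  shows "summable (\<lambda>n. \<bar>err_coeff n\<bar> * real n powr (-\<sigma>))"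
    "(\<Sum>n. \<bar>err_coeff n\<bar> * real n powr (-\<sigma>)) \<le> (\<Sum>n. ln (real n) * real n powr (-\<sigma>)) + (\<Sum>n. real n powr (-\<sigma>))"
proof -
  have s: "summable (\<lambda>n. real n powr (-\<sigma>))" using assms by (simp add: summable_real_powr_iff)
  have le: "\<bar>err_coeff n\<bar> * real n powr (-\<sigma>) \<le> ln (real n) * real n powr (-\<sigma>) + real n powr (-\<sigma>)" for n
  proof -
    have "\<bar>err_coeff n\<bar> \<le> ln (real n) + 1"
      using mangoldt_le_ln[of n] mangoldt_nonneg[of n] by (auto simp: err_coeff_def)
    then have "\<bar>err_coeff n\<bar> * real n powr (-\<sigma>) \<le> (ln (real n) + 1) * real n powr (-\<sigma>)"
      by (intro mult_right_mono) auto
    then show ?thesis by (simp add: algebra_simps)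
  qed
  show sm: "summable (\<lambda>n. \<bar>err_coeff n\<bar> * real n powr (-\<sigma>))"
    by (rule summable_comparison_test'[OF summable_add[OF summable_ln_powr[OF assms] s], of 0])
       (use le in \<open>auto simp: abs_mult\<close>)
  show "(\<Sum>n. \<bar>err_coeff n\<bar> * real n powr (-\<sigma>)) \<le> (\<Sum>n. ln (real n) * real n powr (-\<sigma>)) + (\<Sum>n. real n powr (-\<sigma>))"
    unfolding suminf_add[OF summable_ln_powr[OF assms] s]
    by (intro suminf_le le sm summable_add summable_ln_powr s assms)
qed

text \<open>The pole of \<open>\<zeta>\<close> at 1 is simple, as \<open>\<eta> \<zeta>(1 + \<eta>)\<close> is a value of the bounded function \<open>zeta_reg\<close>.\<close>
lemma powr_series_bound:
  obtains C where "C \<ge> 1" "\<And>\<eta>. 0 < \<eta> \<Longrightarrow> \<eta> \<le> 1 \<Longrightarrow> (\<Sum>n. real n powr (-(1 + \<eta>))) \<le> C / \<eta>"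
proof -
  obtain M where M: "M \<ge> 1" 
    "\<And>s. 159/160 \<le> Re s \<Longrightarrow> Re s \<le> 2 \<Longrightarrow> cmod (zeta_reg s) \<le> M * height s * height s powr (1/40)"
    using zeta_reg_bounds by metis
  define C where "C = M * 3 * 3 powr (1/40)"
  have C1: "C \<ge> 1"
  proof -
    have "(1::real) \<le> 3 powr (1/40)" by (rule ge_one_powr_ge_zero) auto
    then have "1 * 1 \<le> (M * 3) * 3 powr (1/40)" using M(1) by (intro mult_mono) auto
    then show ?thesis by (simp add: C_def)
  qed
  show ?thesis
  proof (rule that[OF C1])
    fix \<eta> :: real assume \<eta>: "0 < \<eta>" "\<eta> \<le> 1"
    let ?s = "of_real (1 + \<eta>) :: complex"
    have sm: "summable (\<lambda>n. real n powr (-(1 + \<eta>)))" using \<eta> by (simp add: summable_real_powr_iff)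
    have eq: "of_nat n powr (- ?s) = complex_of_real (real n powr (-(1 + \<eta>)))" for n
      using powr_of_real[of "real n" "-(1 + \<eta>)"] by simp
    have "(\<Sum>n. of_nat n powr (- ?s)) = complex_of_real (\<Sum>n. real n powr (-(1 + \<eta>)))"
      unfolding eq using suminf_of_real[OF sm, where 'a = complex] by simp
    then have "zeta_reg ?s = complex_of_real (\<eta> * (\<Sum>n. real n powr (-(1 + \<eta>))))"
      using zeta_reg_eq[of ?s] \<eta> by simp
    then have "\<eta> * (\<Sum>n. real n powr (-(1 + \<eta>))) \<le> cmod (zeta_reg ?s)"
      by (metis abs_ge_self norm_of_real)
    also have "\<dots> \<le> C" using M(2)[of ?s] \<eta> by (simp add: C_def height_def)
    finally show "(\<Sum>n. real n powr (-(1 + \<eta>))) \<le> C / \<eta>" using \<eta> by (simp add: field_simps)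
  qed
qed

text \<open>The factor \<open>ln n\<close> is absorbed by half of the exponent \<open>\<eta>\<close>, which costs another factor \<open>1 / \<eta>\<close>.\<close>
lemma err_series_bound:
  obtains C where "C \<ge> 1" "\<And>\<eta>. 0 < \<eta> \<Longrightarrow> \<eta> \<le> 1 \<Longrightarrow> (\<Sum>n. \<bar>err_coeff n\<bar> * real n powr (-(1 + \<eta>))) \<le> C / \<eta>\<^sup>2"
proof -
  obtain C where C: "C \<ge> 1" "\<And>\<eta>. 0 < \<eta> \<Longrightarrow> \<eta> \<le> 1 \<Longrightarrow> (\<Sum>n. real n powr (-(1 + \<eta>))) \<le> C / \<eta>"
    using powr_series_bound by blast
  show ?thesis
  proof (rule that[of "5 * C"])
    fix \<eta> :: real assume \<eta>: "0 < \<eta>" "\<eta> \<le> 1"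
    have sm: "summable (\<lambda>n. 2 / \<eta> * real n powr (-(1 + \<eta> / 2)))"
      using \<eta> by (intro summable_mult) (simp add: summable_real_powr_iff)
    have "(\<Sum>n. ln (real n) * real n powr (-(1 + \<eta>))) \<le> (\<Sum>n. 2 / \<eta> * real n powr (-(1 + \<eta> / 2)))"
    proof (rule suminf_le)
      fix n :: nat
      show "ln (real n) * real n powr (-(1 + \<eta>)) \<le> 2 / \<eta> * real n powr (-(1 + \<eta> / 2))"
      proof (cases "n = 0")
        case False
        then have "ln (real n) * real n powr (-(1 + \<eta>)) \<le> real n powr (\<eta> / 2) / (\<eta> / 2) * real n powr (-(1 + \<eta>))"
          using \<eta> by (intro mult_right_mono ln_powr_bound) auto
        also have "\<dots> = 2 / \<eta> * (real n powr (\<eta> / 2) * real n powr (-(1 + \<eta>)))" by simp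
        also have "real n powr (\<eta> / 2) * real n powr (-(1 + \<eta>)) = real n powr (-(1 + \<eta> / 2))"
          by (simp add: algebra_simps flip: powr_add)
        finally show ?thesis .
      qed simp
    qed (use sm summable_ln_powr[of "1 + \<eta>"] \<eta> in auto)
    also have "\<dots> = 2 / \<eta> * (\<Sum>n. real n powr (-(1 + \<eta> / 2)))"
      using \<eta> by (intro suminf_mult) (simp add: summable_real_powr_iff)
    also have "\<dots> \<le> 2 / \<eta> * (C / (\<eta> / 2))"
      using C(2)[of "\<eta> / 2"] \<eta> by (intro mult_left_mono) auto
    also have "\<dots> = 4 * C / \<eta>\<^sup>2" by (simp add: power2_eq_square)
    finally have 1: "(\<Sum>n. ln (real n) * real n powr (-(1 + \<eta>))) \<le> 4 * C / \<eta>\<^sup>2" .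
    have "(\<Sum>n. real n powr (-(1 + \<eta>))) \<le> C / \<eta>" using C \<eta> by simp
    also have "\<dots> \<le> C / \<eta>\<^sup>2"
      using C \<eta> power_decreasing[of 1 2 \<eta>] by (intro divide_left_mono) auto
    finally have "(\<Sum>n. \<bar>err_coeff n\<bar> * real n powr (-(1 + \<eta>))) \<le> 4 * C / \<eta>\<^sup>2 + C / \<eta>\<^sup>2"
      using summable_err_coeff(2)[of "1 + \<eta>"] 1 \<eta> by simp
    then show "(\<Sum>n. \<bar>err_coeff n\<bar> * real n powr (-(1 + \<eta>))) \<le> 5 * C / \<eta>\<^sup>2" by (simp add: field_simps)
  qed (use C in auto)
qed

definition err_series :: "complex \<Rightarrow> complex" where
  "err_series s = (\<Sum>n. of_real (err_coeff n) * of_nat n powr (-s))"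

lemma err_series_eq:
  assumes "Re s > 1"
  shows "err_series s = - (deriv zeta_reg s / zeta_reg s) - (zeta_reg s - 1) / (s - 1)"
proof -
  have s1: "s - 1 \<noteq> 0" using assms by auto
  have eq: "of_real (err_coeff n) * of_nat n powr (-s) = mangoldt n * of_nat n powr (-s) - of_nat n powr (-s)" for n
    by (cases "n = 0") (auto simp: err_coeff_def algebra_simps)
  have "err_series s = mangoldt_series s - zeta_series s"
    unfolding err_series_def mangoldt_series_def zeta_series_def eq
    using summable_norm_cancel[OF summable_mangoldt[OF assms]] summable_norm_cancel[OF summable_norm_of_nat_powr[OF assms]]
    by (rule suminf_diff[symmetric])
  have op: "open {s. Re s > 1}" by (rule open_halfspace_Re_gt)
  have nz: "zeta_series s \<noteq> 0"
    using zeta_series_341[OF assms, of "Im s"] by auto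
  have reg: "zeta_reg s = (s - 1) * zeta_series s" if "Re s > 1" for s
    using zeta_reg_eq[OF that] by (simp add: zeta_series_def)
  have "((\<lambda>s. (s - 1) * zeta_series s) has_field_derivative
      (zeta_series s - (s - 1) * mangoldt_series s * zeta_series s)) (at s)"
    using zeta_series_ode[OF assms] by (auto intro!: derivative_eq_intros simp: algebra_simps)
  then have "(zeta_reg has_field_derivative (zeta_series s - (s - 1) * mangoldt_series s * zeta_series s)) (at s)"
    by (rule has_field_derivative_transform_within_open[OF _ op]) (use assms reg in auto)
  then have d: "deriv zeta_reg s = zeta_series s - (s - 1) * mangoldt_series s * zeta_series s"
    by (rule DERIV_imp_deriv)
  have alg: "m - z = - ((z - u * m * z) / (u * z)) - (u * z - 1) / u" if "u \<noteq> 0" "z \<noteq> 0" for u z m :: complex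
    using that by (simp add: field_simps)
  show ?thesis
    unfolding \<open>err_series s = _\<close> d reg[OF assms] using s1 nz by (rule alg)
qed

text \<open>
  Integration term by term, by uniform convergence on the segment; the \<open>n\<close>-th term is the kernel for
  \<open>y = X / n\<close>.
\<close>
lemma perron_err:
  fixes X c T :: real
  assumes X: "X > 0" and c: "1 < c" "c \<le> 2" and T: "T \<ge> 3"
  shows "cmod (contour_integral (linepath (Complex c (-T)) (Complex c T)) (\<lambda>s. err_series s * of_real X powr s / (s * (s + 1)))
            - 2 * pi * \<i> * of_real (smoothed_err X)) \<le> 6 * X powr c / T * (\<Sum>n. \<bar>err_coeff n\<bar> * real n powr (-c))"
proof -
  let ?l = "linepath (Complex c (-T)) (Complex c T)"
  let ?S = "closed_segment (Complex c (-T)) (Complex c T)"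
  define f where "f = (\<lambda>n (s::complex). of_real (err_coeff n) * of_nat n powr (-s) * (of_real X powr s / (s * (s + 1))))"
  \<comment> \<open>the limits of the kernels: they vanish for \<open>n > X\<close>, and at \<open>n = 0\<close> the integrand is zero\<close>
  define W where "W = (\<lambda>n. if n = 0 then 0 else err_coeff n * max 0 (1 - real n / X))"
  have S: "Re s = c" if "s \<in> ?S" for s
    using that by (auto simp: closed_segment_same_Re)
  have nz: "s \<noteq> 0" "s + 1 \<noteq> 0" "cmod s \<ge> 1" "cmod (s + 1) \<ge> 1" if "s \<in> ?S" for s
    using S[OF that] c complex_Re_le_cmod[of s] complex_Re_le_cmod[of "s + 1"] by (auto simp: add_eq_0_iff2)
  have X0: "complex_of_real X \<noteq> 0" using X by simp
  have unif: "uniform_limit ?S (\<lambda>N s. \<Sum>n<N. f n s) (\<lambda>s. \<Sum>n. f n s) sequentially"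
  proof (rule Weierstrass_m_test)
    fix n s assume s: "s \<in> ?S"
    have "cmod (f n s) = \<bar>err_coeff n\<bar> * real n powr (-c) * (X powr c / (cmod s * cmod (s + 1)))"
      using S[OF s] X by (simp add: f_def norm_mult norm_divide norm_of_real_powr)
    also have "\<dots> \<le> \<bar>err_coeff n\<bar> * real n powr (-c) * (X powr c / (1 * 1))"
      using nz[OF s] by (intro mult_left_mono divide_left_mono mult_mono mult_pos_pos) auto
    finally show "cmod (f n s) \<le> \<bar>err_coeff n\<bar> * real n powr (-c) * X powr c" by simp
  next
    show "summable (\<lambda>n. \<bar>err_coeff n\<bar> * real n powr (-c) * X powr c)"
      by (intro summable_mult2 summable_err_coeff c)
  qed
  have cont: "continuous_on ?S (f n)" for n
  proof (cases "n = 0")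
    case True
    then show ?thesis by (simp add: f_def)
  next
    case False
    then show ?thesis unfolding f_def
      by (intro holomorphic_on_imp_continuous_on holomorphic_intros) (use X0 nz in auto)
  qed
  obtain J where J: "((\<lambda>s. \<Sum>n. f n s) has_contour_integral J) ?l"
      "(\<lambda>n. contour_integral ?l (f n)) sums J"
    using contour_integral_sums_linepath[OF unif cont] by blast
  have "((\<lambda>s. err_series s * of_real X powr s / (s * (s + 1))) has_contour_integral J) ?l"
  proof (rule has_contour_integral_eq[OF J(1)])
    fix s assume "s \<in> path_image ?l"
    then have s: "s \<in> ?S" by simp
    have "summable (\<lambda>n. of_real (err_coeff n) * of_nat n powr (-s))"
      using summable_err_coeff(1)[OF c(1)] S[OF s] by (rule_tac summable_norm_cancel) (simp add: norm_mult)
    then show "(\<Sum>n. f n s) = err_series s * of_real X powr s / (s * (s + 1))"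
      unfolding f_def err_series_def by (subst suminf_mult2[symmetric]) simp_all
  qed
  then have CI: "contour_integral ?l (\<lambda>s. err_series s * of_real X powr s / (s * (s + 1))) = J"
    by (rule contour_integral_unique)
  have "W sums (\<Sum>n | 1 \<le> n \<and> real n \<le> X. W n)"
  proof (rule sums_finite)
    show "finite {n. 1 \<le> n \<and> real n \<le> X}"
      by (rule finite_subset[of _ "{..nat \<lfloor>X\<rfloor>}"]) (auto simp: le_nat_floor)
    show "W n = 0" if "n \<notin> {n. 1 \<le> n \<and> real n \<le> X}" for n
      using that X by (auto simp: W_def not_le Suc_le_eq)
  qed
  also have "(\<Sum>n | 1 \<le> n \<and> real n \<le> X. W n) = smoothed_err X"
    unfolding smoothed_err_def using X by (intro sum.cong) (auto simp: W_def)
  finally have Ws: "W sums smoothed_err X" .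
  have "(\<lambda>n. 2 * pi * \<i> * of_real (W n)) sums (2 * pi * \<i> * of_real (smoothed_err X))"
    using Ws by (intro sums_mult sums_of_real)
  from sums_diff[OF J(2) this]
  have D: "(\<lambda>n. contour_integral ?l (f n) - 2 * pi * \<i> * of_real (W n)) sums (J - 2 * pi * \<i> * of_real (smoothed_err X))" .
  have bound: "cmod (contour_integral ?l (f n) - 2 * pi * \<i> * of_real (W n)) \<le> 6 * X powr c / T * (\<bar>err_coeff n\<bar> * real n powr (-c))" for n
  proof (cases "n = 0")
    case True
    then show ?thesis by (simp add: f_def W_def)
  next
    case False
    define y where "y = X / real n"
    have y: "y > 0" using X False by (simp add: y_def)
    define g where "g = (\<lambda>s :: complex. of_real y powr s / (s * (s + 1)))"
    have fg: "f n s = of_real (err_coeff n) * g s" for s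
    proof -
      have "of_real X powr s = (of_nat n * of_real y) powr s" using False by (simp add: y_def)
      also have "\<dots> = of_nat n powr s * of_real y powr s" using y by (subst powr_times_real) auto
      finally have "of_nat n powr (-s) * of_real X powr s = of_real y powr s"
        using False by (simp add: powr_minus field_simps)
      then show ?thesis by (simp add: f_def g_def mult.assoc)
    qed
    have gi: "g contour_integrable_on ?l"
      unfolding g_def
      by (intro contour_integrable_continuous_linepath holomorphic_on_imp_continuous_on holomorphic_intros)
         (use nz y in auto)
    have fg': "f n = (\<lambda>s. of_real (err_coeff n) * g s)" using fg by auto
    have "contour_integral ?l (f n) = of_real (err_coeff n) * contour_integral ?l g"
      unfolding fg' by (rule contour_integral_lmul[OF gi])
    moreover have "W n = err_coeff n * max 0 (1 - 1 / y)" using False X by (simp add: W_def y_def)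
    ultimately have "contour_integral ?l (f n) - 2 * pi * \<i> * of_real (W n) =
        of_real (err_coeff n) * (contour_integral ?l g - 2 * pi * \<i> * of_real (max 0 (1 - 1 / y)))"
      by (simp add: algebra_simps)
    also have "cmod \<dots> \<le> \<bar>err_coeff n\<bar> * (6 * y powr c / T)"
      unfolding norm_mult norm_of_real g_def
      by (intro mult_left_mono perron_kernel) (use y c T in auto)
    also have "y powr c = X powr c * real n powr (-c)"
      using X False by (simp add: y_def powr_divide powr_minus_divide)
    finally show ?thesis by (simp add: mult_ac)
  qed
  have "cmod (J - 2 * pi * \<i> * of_real (smoothed_err X)) = cmod (\<Sum>n. contour_integral ?l (f n) - 2 * pi * \<i> * of_real (W n))"
    using D by (simp add: sums_iff)
  also have "\<dots> \<le> (\<Sum>n. 6 * X powr c / T * (\<bar>err_coeff n\<bar> * real n powr (-c)))"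
    by (intro norm_suminf_le bound summable_mult summable_err_coeff c)
  also have "\<dots> = 6 * X powr c / T * (\<Sum>n. \<bar>err_coeff n\<bar> * real n powr (-c))"
    by (intro suminf_mult summable_err_coeff c)
  finally show ?thesis unfolding CI .
qed

section \<open>Shifting the contour\<close>

text \<open>
  The continuation of \<open>err_series\<close>: the poles of \<open>- \<zeta>' / \<zeta>\<close> and \<open>\<zeta>\<close> at 1 cancel, leaving a
  removable singularity that is filled in by the derivative.
\<close>
definition err_cont :: "complex \<Rightarrow> complex" where
  "err_cont s = - (deriv zeta_reg s / zeta_reg s)
     - (if s = 1 then deriv zeta_reg 1 else (zeta_reg s - zeta_reg 1) / (s - 1))"

text \<open>
  On the line \<open>Re s = 1 + 1 / ln X\<close> the power \<open>X powr Re s\<close> is just \<open>exp 1 * X\<close>, and on the left side of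
  the rectangle it is \<open>X * exp (- c * sqrt (ln X))\<close>.
\<close>
lemma smoothed_err_bound:
  obtains c M where "c > 0" "M \<ge> 1"
    "\<And>X x. x = ln X \<Longrightarrow> X \<ge> exp 2 \<Longrightarrow> \<bar>smoothed_err X\<bar> \<le> M * X * (1 / x\<^sup>2 + x ^ 8 * exp (- c * sqrt x))"
proof -
  obtain c M where c: "0 < c" "c \<le> 1/160" and M: "M \<ge> 1"
    and zf: "\<And>T s. T \<ge> 1 \<Longrightarrow> \<bar>Im s\<bar> \<le> T \<Longrightarrow> 1 - c / T powr (1/8) \<le> Re s \<Longrightarrow> Re s \<le> 2 \<Longrightarrow>
       zeta_reg s \<noteq> 0 \<and> cmod (deriv zeta_reg s / zeta_reg s) \<le> M * T powr (1/8)"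
    using zero_free_region by metis
  obtain K where K: "K \<ge> 1" "\<And>\<eta>. 0 < \<eta> \<Longrightarrow> \<eta> \<le> 1 \<Longrightarrow> (\<Sum>n. \<bar>err_coeff n\<bar> * real n powr (-(1 + \<eta>))) \<le> K / \<eta>\<^sup>2"
    using err_series_bound by blast
  define M2 where "M2 = M + 4 * zeta_sum_const"
  have M2: "M2 \<ge> 1" using M zeta_sum_const_nonneg by (simp add: M2_def)
  define M3 where "M3 = 6 * exp 1 * K + 4 * exp 1 * M2 + 4 * M2"
  have M3: "M3 \<ge> 1"
    using M2 K by (simp add: M3_def add_increasing)
  show ?thesis
  proof (rule that[of c M3])
    fix X x :: real assume x: "x = ln X" and X: "X \<ge> exp 2"
    have X0: "X > 0" using X exp_gt_zero[of 2] by linarith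
    have x2: "x \<ge> 2" using X X0 unfolding x by (simp add: ln_ge_iff)
    \<comment> \<open>the truncation error is of order \<open>X * x\<^sup>2 / T\<close>, and the zero-free region up to height \<open>T\<close> has width \<open>c / sqrt x\<close>\<close>
    define T where "T = x ^ 4"
    have T16: "T \<ge> 16" using power_mono[of 2 x 4] x2 by (simp add: T_def)
    define b where "b = 1 + 1 / x"
    define a where "a = 1 - c / sqrt x"
    have T8: "T powr (1/8) = sqrt x"
    proof -
      have "T = x powr 4" using x2 by (simp add: T_def)
      then have "T powr (1/8) = x powr (1/2)" by (simp add: powr_powr)
      then show ?thesis using x2 by (simp add: powr_half_sqrt)
    qed
    have sx: "sqrt x \<ge> 1" using x2 by simp
    have "c / sqrt x \<le> c / 1" using c sx by (intro divide_left_mono) auto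
    moreover have "0 < c / sqrt x" using c x2 by simp
    ultimately have a: "a < 1" "a \<ge> 159/160" using c unfolding a_def by linarith+
    have b: "1 < b" "b \<le> 3/2" using x2 by (auto simp: b_def field_simps)
    have Xb: "X powr b = exp 1 * X"
      using X0 x2 by (simp add: b_def powr_def x[symmetric] algebra_simps exp_add) (simp add: x)
    have Xa: "X powr a = X * exp (- c * sqrt x)"
    proof -
      have "a * x = x - c * (x / sqrt x)" by (simp add: a_def algebra_simps)
      also have "x / sqrt x = sqrt x" using x2 by (intro real_div_sqrt) auto
      finally have "a * x = x + (- c * sqrt x)" by simp
      then have "X powr a = exp x * exp (- c * sqrt x)"
        using X0 unfolding powr_def x[symmetric] exp_add[symmetric] by simp
      then show ?thesis using X0 by (simp add: x)
    qed
    define R where "R = cbox (Complex a (-T)) (Complex b T)"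
    have R: "s \<in> R \<longleftrightarrow> a \<le> Re s \<and> Re s \<le> b \<and> \<bar>Im s\<bar> \<le> T" for s
      by (auto simp: R_def in_cbox_complex_iff)
    have zR: "zeta_reg s \<noteq> 0" "cmod (deriv zeta_reg s / zeta_reg s) \<le> M * sqrt x" if "s \<in> R" for s
      using zf[of T s] that b T16 T8 by (auto simp: R a_def)
    define G where "G = (\<lambda>s :: complex. err_cont s * of_real X powr s / (s * (s + 1)))"
    have Rsub: "R \<subseteq> zeta_halfplane" using a by (auto simp: R)
    have nz: "s \<noteq> 0" "s + 1 \<noteq> 0" if "s \<in> R" for s
      using that a by (auto simp: R add_eq_0_iff2)
    have "err_cont holomorphic_on R"
    proof -
      have "deriv zeta_reg holomorphic_on zeta_halfplane"
        by (intro holomorphic_deriv holomorphic_zeta_reg open_halfspace_Re_gt)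
      then have 1: "deriv zeta_reg holomorphic_on R" "zeta_reg holomorphic_on R"
        using holomorphic_zeta_reg Rsub holomorphic_on_subset by blast+
      have 2: "(\<lambda>s. if s = 1 then deriv zeta_reg 1 else (zeta_reg s - zeta_reg 1) / (s - 1)) holomorphic_on R"
        using pole_lemma_open[OF holomorphic_zeta_reg open_halfspace_Re_gt] Rsub by (rule holomorphic_on_subset)
      show ?thesis unfolding err_cont_def[abs_def]
        by (intro holomorphic_on_diff holomorphic_on_minus holomorphic_on_divide 1 2) (use zR in auto)
    qed
    then have holG: "G holomorphic_on R"
      unfolding G_def by (intro holomorphic_intros) (use X0 nz in auto)
    have contG: "continuous_on R G" by (rule holomorphic_on_imp_continuous_on[OF holG])
    have bnd: "cmod (err_cont s) \<le> M2 * sqrt x" if s: "s \<in> R" "s \<noteq> 1" for s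
    proof -
      have "cmod s \<le> \<bar>Re s\<bar> + \<bar>Im s\<bar>" by (rule cmod_le)
      also have "\<dots> \<le> 4 * T" using s a b T16 by (auto simp: R)
      finally have "cmod s powr (1/40) \<le> (4 * T) powr (1/40)" by (intro powr_mono2) auto
      also have "\<dots> \<le> (4 * T) powr (1/8)" using T16 by (intro powr_mono) auto
      also have "\<dots> = 4 powr (1/8) * sqrt x" using T8 powr_mult[of 4 T "1/8"] by simp
      also have "4 powr (1/8) \<le> (4 powr (1/2) :: real)" by (rule powr_mono) auto
      also have "4 powr (1/2) = (2::real)" by (simp add: powr_half_sqrt)
      finally have p: "cmod s powr (1/40) \<le> 2 * sqrt x" using sx by (simp add: mult_right_mono)
      have "cmod (zeta_reg s - 1) \<le> 2 * zeta_sum_const * cmod (s - 1) * cmod s powr (1/40)"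
        using s a by (intro norm_zeta_reg_minus_1_le) (auto simp: R)
      also have "\<dots> \<le> 2 * zeta_sum_const * cmod (s - 1) * (2 * sqrt x)"
        using p zeta_sum_const_nonneg by (intro mult_left_mono) auto
      finally have q: "cmod ((zeta_reg s - 1) / (s - 1)) \<le> 4 * zeta_sum_const * sqrt x"
        using s by (simp add: norm_divide pos_divide_le_eq mult_ac)
      have "cmod (err_cont s) \<le> cmod (deriv zeta_reg s / zeta_reg s) + cmod ((zeta_reg s - 1) / (s - 1))"
        using s norm_triangle_ineq4[of "- (deriv zeta_reg s / zeta_reg s)" "(zeta_reg s - 1) / (s - 1)"]
        by (simp add: err_cont_def)
      also have "\<dots> \<le> M * sqrt x + 4 * zeta_sum_const * sqrt x"
        using zR(2)[OF s(1)] q by (rule add_mono)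
      finally show ?thesis by (simp add: M2_def algebra_simps)
    qed
    let ?right = "contour_integral (linepath (Complex b (-T)) (Complex b T)) G"
    let ?left = "contour_integral (linepath (Complex a (-T)) (Complex a T)) G"
    have sub: "path_image (rectpath (Complex a (-T)) (Complex b T)) \<subseteq> R"
      unfolding R_def using a b T16 by (intro path_image_rectpath_subset_cbox) auto
    have I: "(G has_contour_integral 0) (rectpath (Complex a (-T)) (Complex b T))"
      by (rule Cauchy_theorem_convex_simple[OF holG]) (use sub in \<open>auto simp: R_def\<close>)
    have sqT: "sqrt x \<le> x" using x2 by (simp add: real_le_lsqrt sqrt_le_D self_le_power)
    have "cmod (?right - ?left - 0) \<le> 2 * (b - a) * (M2 * sqrt x * (exp 1 * X) / T\<^sup>2)"
    proof (rule contour_integral_vertical_shift[OF _ _ _ I])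
      show "continuous_on (path_image (rectpath (Complex a (-T)) (Complex b T))) G"
        using contG sub by (rule continuous_on_subset)
      fix s assume s: "a \<le> Re s" "Re s \<le> b" "\<bar>Im s\<bar> = T"
      have sR: "s \<in> R" "s \<noteq> 1" using s T16 by (auto simp: R)
      have "cmod s \<ge> T" "cmod (s + 1) \<ge> T"
        using s abs_Im_le_cmod[of s] abs_Im_le_cmod[of "s + 1"] by auto
      then have den: "T\<^sup>2 \<le> cmod s * cmod (s + 1)"
        unfolding power2_eq_square using T16 by (intro mult_mono) auto
      have num: "X powr Re s \<le> exp 1 * X"
        unfolding Xb[symmetric] using s X0 x2 x exp_ge_add_one_self[of 2] X by (intro powr_mono) auto
      have "cmod (G s) = cmod (err_cont s) * X powr Re s / (cmod s * cmod (s + 1))"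
        using X0 by (simp add: G_def norm_mult norm_divide norm_of_real_powr)
      also have "\<dots> \<le> M2 * sqrt x * (exp 1 * X) / T\<^sup>2"
        using bnd[OF sR] num den M2 sx T16 X0 by (intro frac_le mult_mono) auto
      finally show "cmod (G s) \<le> M2 * sqrt x * (exp 1 * X) / T\<^sup>2" .
    qed (use a b T16 in auto)
    also have "\<dots> \<le> 2 * 1 * (M2 * sqrt x * (exp 1 * X) / T\<^sup>2)"
      using a b c M2 sx X0 x2 by (intro mult_right_mono) (auto simp: field_simps)
    finally have hor: "cmod (?right - ?left) \<le> 2 * (M2 * sqrt x * (exp 1 * X) / T\<^sup>2)" by simp
    have left: "cmod ?left \<le> 2 * T * (M2 * sqrt x * (X * exp (- c * sqrt x)) / (1/2))"
    proof (rule contour_integral_vertical_bound)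
      show "continuous_on {s. Re s = a \<and> \<bar>Im s\<bar> \<le> T} G"
        using contG by (rule continuous_on_subset) (use a b in \<open>auto simp: R\<close>)
      fix s assume s: "Re s = a" "\<bar>Im s\<bar> \<le> T"
      have sR: "s \<in> R" "s \<noteq> 1" using s a b by (auto simp: R)
      have "cmod s \<ge> 1/2" "cmod (s + 1) \<ge> 1"
        using s a complex_Re_le_cmod[of s] complex_Re_le_cmod[of "s + 1"] by auto
      then have den: "1/2 \<le> cmod s * cmod (s + 1)"
        using mult_mono[of "1/2" "cmod s" 1 "cmod (s + 1)"] by simp
      have "cmod (G s) = cmod (err_cont s) * X powr a / (cmod s * cmod (s + 1))"
        using X0 s by (simp add: G_def norm_mult norm_divide norm_of_real_powr)
      also have "\<dots> \<le> M2 * sqrt x * X powr a / (1/2)"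
        using bnd[OF sR] den M2 sx by (intro frac_le mult_mono) auto
      finally show "cmod (G s) \<le> M2 * sqrt x * (X * exp (- c * sqrt x)) / (1/2)" unfolding Xa .
    qed (use T16 in auto)
    have rightP: "cmod (?right - 2 * pi * \<i> * of_real (smoothed_err X)) \<le> 6 * (exp 1 * X) / T * (K * x\<^sup>2)"
    proof -
      have "?right = contour_integral (linepath (Complex b (-T)) (Complex b T)) (\<lambda>s. err_series s * of_real X powr s / (s * (s + 1)))"
      proof (rule contour_integral_eq)
        fix s assume "s \<in> path_image (linepath (Complex b (-T)) (Complex b T))"
        then have "Re s > 1" using b by (auto simp: closed_segment_same_Re)
        moreover from this have "s \<noteq> 1" by auto
        ultimately show "G s = err_series s * of_real X powr s / (s * (s + 1))"
          by (simp add: G_def err_cont_def err_series_eq)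
      qed
      also have "cmod (\<dots> - 2 * pi * \<i> * of_real (smoothed_err X)) \<le> 6 * X powr b / T * (\<Sum>n. \<bar>err_coeff n\<bar> * real n powr (-b))"
        by (rule perron_err) (use X0 b T16 in auto)
      also have "\<dots> \<le> 6 * X powr b / T * (K / (1 / x)\<^sup>2)"
        unfolding b_def using K(2)[of "1 / x"] x2 T16 by (intro mult_left_mono) auto
      also have "K / (1 / x)\<^sup>2 = K * x\<^sup>2" by (simp add: power_divide)
      finally show ?thesis by (simp add: Xb)
    qed
    have "2 * pi * \<bar>smoothed_err X\<bar> = cmod (2 * pi * \<i> * of_real (smoothed_err X))"
      by (simp add: norm_mult)
    also have "\<dots> \<le> cmod (?right - 2 * pi * \<i> * of_real (smoothed_err X)) + cmod (?right - ?left) + cmod ?left"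
      using norm_triangle_ineq2[of "2 * pi * \<i> * of_real (smoothed_err X)" ?right] norm_triangle_ineq2[of ?right ?left]
      by (simp add: norm_minus_commute)
    also have "\<dots> \<le> 6 * (exp 1 * X) / T * (K * x\<^sup>2) + 2 * (M2 * sqrt x * (exp 1 * X) / T\<^sup>2)
        + 2 * T * (M2 * sqrt x * (X * exp (- c * sqrt x)) / (1/2))"
      using rightP hor left by linarith
    also have "\<dots> \<le> 6 * exp 1 * K * X * (1 / x\<^sup>2) + 4 * exp 1 * M2 * X * (1 / x\<^sup>2) + 4 * M2 * X * (x ^ 8 * exp (- c * sqrt x))"
    proof (intro add_mono)
      show "6 * (exp 1 * X) / T * (K * x\<^sup>2) \<le> 6 * exp 1 * K * X * (1 / x\<^sup>2)"
        using x2 by (simp add: T_def field_simps eval_nat_numeral)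
      have "sqrt x / T\<^sup>2 \<le> x ^ 6 / T\<^sup>2"
        using sqT x2 power_increasing[of 1 6 x] T16 by (intro divide_right_mono) auto
      also have "\<dots> = 1 / x\<^sup>2" using x2 by (simp add: T_def field_simps flip: power_mult power_add)
      finally have "2 * M2 * exp 1 * X * (sqrt x / T\<^sup>2) \<le> 2 * M2 * exp 1 * X * (1 / x\<^sup>2)"
        using M2 X0 by (intro mult_left_mono) auto
      also have "\<dots> \<le> 2 * (2 * M2 * exp 1 * X * (1 / x\<^sup>2))"
      proof -
        have "0 \<le> 2 * M2 * exp 1 * X * (1 / x\<^sup>2)" using M2 X0 by (intro mult_nonneg_nonneg) auto
        moreover have "y \<le> 2 * y" if "y \<ge> 0" for y :: real using that by simp
        ultimately show ?thesis by blast
      qed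
      finally show "2 * (M2 * sqrt x * (exp 1 * X) / T\<^sup>2) \<le> 4 * exp 1 * M2 * X * (1 / x\<^sup>2)"
        by (simp add: mult_ac)
      have "T * sqrt x \<le> x ^ 4 * x ^ 4"
        unfolding T_def using sqT x2 power_increasing[of 1 4 x] by (intro mult_left_mono) auto
      then have "4 * M2 * X * exp (- c * sqrt x) * (T * sqrt x) \<le> 4 * M2 * X * exp (- c * sqrt x) * x ^ 8"
        using M2 X0 by (intro mult_left_mono) (auto simp flip: power_add)
      then show "2 * T * (M2 * sqrt x * (X * exp (- c * sqrt x)) / (1/2)) \<le> 4 * M2 * X * (x ^ 8 * exp (- c * sqrt x))"
        by (simp add: mult_ac)
    qed
    also have "\<dots> \<le> M3 * X * (1 / x\<^sup>2) + M3 * X * (x ^ 8 * exp (- c * sqrt x))"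
    proof -
      have "(6 * exp 1 * K + 4 * exp 1 * M2) * (X * (1 / x\<^sup>2)) \<le> M3 * (X * (1 / x\<^sup>2))"
        using M2 X0 by (intro mult_right_mono) (auto simp: M3_def)
      moreover have "4 * M2 * (X * (x ^ 8 * exp (- c * sqrt x))) \<le> M3 * (X * (x ^ 8 * exp (- c * sqrt x)))"
        using M2 K X0 x2 by (intro mult_right_mono) (auto simp: M3_def)
      ultimately show ?thesis by (simp add: algebra_simps)
    qed
    finally have "2 * pi * \<bar>smoothed_err X\<bar> \<le> M3 * X * (1 / x\<^sup>2 + x ^ 8 * exp (- c * sqrt x))"
      by (simp add: algebra_simps)
    moreover have "1 * \<bar>smoothed_err X\<bar> \<le> 2 * pi * \<bar>smoothed_err X\<bar>"
      using pi_gt3 by (intro mult_right_mono) auto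
    ultimately show "\<bar>smoothed_err X\<bar> \<le> M3 * X * (1 / x\<^sup>2 + x ^ 8 * exp (- c * sqrt x))" by linarith
  qed (use c M3 in auto)
qed

lemma smoothed_err_bigo: "smoothed_err \<in> O(\<lambda>X. X / (ln X)\<^sup>2)"
proof -
  obtain c M where c: "c > 0" "M \<ge> 1"
    "\<And>X x. x = ln X \<Longrightarrow> X \<ge> exp 2 \<Longrightarrow> \<bar>smoothed_err X\<bar> \<le> M * X * (1 / x\<^sup>2 + x ^ 8 * exp (- c * sqrt x))"
    using smoothed_err_bound by metis
  have "smoothed_err \<in> O(\<lambda>X. M * X * (1 / (ln X)\<^sup>2 + (ln X) ^ 8 * exp (- c * sqrt (ln X))))"
    by (rule bigoI[of _ 1], rule eventually_mono[OF eventually_ge_at_top[of "exp 2"]])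
       (use c(3) in \<open>auto intro: order_trans[OF _ abs_ge_self]\<close>)
  also have "(\<lambda>X. M * X * (1 / (ln X)\<^sup>2 + (ln X) ^ 8 * exp (- c * sqrt (ln X)))) \<in> O(\<lambda>X. X / (ln X)\<^sup>2)"
    using c(1,2) by real_asymp
  finally show ?thesis .
qed

section \<open>From smoothed sums to the Chebyshev functions\<close>

definition chebyshev_psi :: "real \<Rightarrow> real" where
  "chebyshev_psi X = (\<Sum>n | 1 \<le> n \<and> real n \<le> X. mangoldt n)"

definition chebyshev_psi1 :: "real \<Rightarrow> real" where
  "chebyshev_psi1 X = (\<Sum>n | 1 \<le> n \<and> real n \<le> X. mangoldt n * (X - real n))"

lemma finite_le_real [simp]: "finite {n. Suc 0 \<le> n \<and> real n \<le> X}"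
  by (rule finite_subset[of _ "{..nat \<lfloor>X\<rfloor>}"]) (auto simp: le_nat_floor)

lemma sum_distance_bound:
  assumes "X \<ge> 1"
  shows "\<bar>(\<Sum>n | 1 \<le> n \<and> real n \<le> X. X - real n) - X\<^sup>2 / 2\<bar> \<le> X"
proof -
  define N where "N = nat \<lfloor>X\<rfloor>"
  define f where "f = X - real N"
  have f: "0 \<le> f" "f \<le> 1" "X = real N + f"
    using assms by (auto simp: f_def N_def) linarith+
  have set: "{n. 1 \<le> n \<and> real n \<le> X} = {1..N}"
    using assms by (auto simp: N_def le_nat_floor nat_le_iff le_floor_iff) linarith
  have "(\<Sum>n\<in>{1..N}. X - real n) = real N * X - real N * (real N + 1) / 2"
    using double_gauss_sum[of N, where 'a = real]
    by (simp add: sum_subtractf atLeast1_atMost_eq_remove0 sum_diff1 atLeast0AtMost)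
  then have D: "(\<Sum>n\<in>{1..N}. X - real n) - X\<^sup>2 / 2 = - ((real N + f * f) / 2)"
    unfolding f(3) by (simp add: power2_eq_square field_simps)
  have "f * f \<le> f" "0 \<le> f * f" using f mult_left_le[of f f] by auto
  then have "(real N + f * f) / 2 \<le> X" "0 \<le> (real N + f * f) / 2" using f by auto
  then show ?thesis unfolding set D abs_minus_cancel by simp
qed

lemma psi1_minus_half_square:
  assumes "X \<ge> 1"
  shows "\<bar>chebyshev_psi1 X - X\<^sup>2 / 2\<bar> \<le> X * \<bar>smoothed_err X\<bar> + X"
proof -
  have "X * smoothed_err X = (\<Sum>n | 1 \<le> n \<and> real n \<le> X. mangoldt n * (X - real n) - (X - real n))"
    unfolding smoothed_err_def sum_distrib_left
    by (intro sum.cong) (use assms in \<open>auto simp: err_coeff_def field_simps\<close>)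
  then have "chebyshev_psi1 X - X\<^sup>2 / 2 = X * smoothed_err X + ((\<Sum>n | 1 \<le> n \<and> real n \<le> X. X - real n) - X\<^sup>2 / 2)"
    by (simp add: chebyshev_psi1_def sum_subtractf)
  also have "\<bar>\<dots>\<bar> \<le> \<bar>X * smoothed_err X\<bar> + \<bar>(\<Sum>n | 1 \<le> n \<and> real n \<le> X. X - real n) - X\<^sup>2 / 2\<bar>"
    by (rule abs_triangle_ineq)
  finally show ?thesis using sum_distance_bound[OF assms] assms by (simp add: abs_mult)
qed

text \<open>The function \<open>chebyshev_psi1\<close> is a primitive of the nondecreasing function \<open>chebyshev_psi\<close>, hence convex.\<close>
lemma chebyshev_psi1_slope:
  assumes "X \<le> Y"
  shows "(Y - X) * chebyshev_psi X \<le> chebyshev_psi1 Y - chebyshev_psi1 X"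
    "chebyshev_psi1 Y - chebyshev_psi1 X \<le> (Y - X) * chebyshev_psi Y"
proof -
  let ?A = "\<lambda>X. {n. 1 \<le> n \<and> real n \<le> X}"
  have sub: "?A X \<subseteq> ?A Y" using assms by auto
  have 1: "chebyshev_psi1 X = (\<Sum>n\<in>?A Y. mangoldt n * max 0 (X - real n))"
    unfolding chebyshev_psi1_def by (intro sum.mono_neutral_cong_left sub) auto
  have 2: "chebyshev_psi X = (\<Sum>n\<in>?A Y. mangoldt n * (if real n \<le> X then 1 else 0))"
    unfolding chebyshev_psi_def by (intro sum.mono_neutral_cong_left sub) auto
  have 3: "chebyshev_psi1 Y - chebyshev_psi1 X = (\<Sum>n\<in>?A Y. mangoldt n * (Y - real n - max 0 (X - real n)))"
    unfolding 1 by (simp add: chebyshev_psi1_def right_diff_distrib sum_subtractf)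
  show "(Y - X) * chebyshev_psi X \<le> chebyshev_psi1 Y - chebyshev_psi1 X"
    unfolding 2 3 sum_distrib_left
    by (intro sum_mono) (auto simp: mangoldt_nonneg mult_left_mono mult.commute max_def)
  show "chebyshev_psi1 Y - chebyshev_psi1 X \<le> (Y - X) * chebyshev_psi Y"
    unfolding 3 chebyshev_psi_def sum_distrib_left mult.commute[of "Y - X"]
    by (intro sum_mono mult_left_mono mangoldt_nonneg) (use assms in \<open>auto simp: max_def\<close>)
qed

text \<open>
  Let \<open>e\<close> be the error of \<open>chebyshev_psi1\<close>, of order \<open>X\<^sup>2 / (ln X)\<^sup>2\<close>. The slopes of
  \<open>chebyshev_psi1\<close> over steps of length \<open>h\<close> on either side of \<open>X\<close> determine \<open>chebyshev_psi X\<close> up to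
  \<open>h\<close> plus a multiple of \<open>e / h\<close>; the best step is \<open>h = X / ln X\<close>.
\<close>
lemma chebyshev_psi_asymptotic: "(\<lambda>X. chebyshev_psi X - X) \<in> O(\<lambda>X. X / ln X)"
proof -
  have "(\<lambda>X. X * \<bar>smoothed_err X\<bar> + X) \<in> O(\<lambda>X. X\<^sup>2 / (ln X)\<^sup>2)"
  proof (rule sum_in_bigo)
    have "(\<lambda>X. X * \<bar>smoothed_err X\<bar>) \<in> O(\<lambda>X. X * (X / (ln X)\<^sup>2))"
      using smoothed_err_bigo by (intro landau_o.big.mult) auto
    then show "(\<lambda>X. X * \<bar>smoothed_err X\<bar>) \<in> O(\<lambda>X. X\<^sup>2 / (ln X)\<^sup>2)"
      by (simp add: power2_eq_square)
    show "(\<lambda>X::real. X) \<in> O(\<lambda>X. X\<^sup>2 / (ln X)\<^sup>2)" by real_asymp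
  qed
  then obtain C where C: "C > 0" "eventually (\<lambda>X. norm (X * \<bar>smoothed_err X\<bar> + X) \<le> C * norm (X\<^sup>2 / (ln X)\<^sup>2)) at_top"
    by (elim landau_o.bigE)
  then obtain X0 where X0: "\<And>X. X \<ge> X0 \<Longrightarrow> norm (X * \<bar>smoothed_err X\<bar> + X) \<le> C * norm (X\<^sup>2 / (ln X)\<^sup>2)"
    unfolding eventually_at_top_linorder by blast
  have P1: "\<bar>chebyshev_psi1 X - X\<^sup>2 / 2\<bar> \<le> C * (X\<^sup>2 / (ln X)\<^sup>2)" if "X \<ge> X0" "X \<ge> 1" for X
    using psi1_minus_half_square[OF that(2)] X0[OF that(1)] that by simp
  have "\<bar>chebyshev_psi X - X\<bar> \<le> (1 + 5 * C) * (X / ln X)"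
    if X: "X \<ge> 2 * max X0 (exp 2)" for X
  proof -
    define x where "x = ln X"
    define h where "h = X / x"
    define e where "e = C * (X\<^sup>2 / x\<^sup>2)"
    have X2: "X \<ge> 2 * X0" "X \<ge> 2 * exp 2" using X by auto
    have Xe: "exp 2 \<le> X" "X > 0" using X2(2) exp_gt_zero[of "2::real"] by linarith+
    have x2: "x \<ge> 2" unfolding x_def using Xe by (simp add: ln_ge_iff)
    have e2: "exp 2 \<ge> (3::real)" using exp_ge_add_one_self[of "2::real"] by simp
    have h: "h > 0" "h \<le> X / 2" using x2 Xe by (auto simp: h_def field_simps)
    have hx: "h * x = X" using x2 by (simp add: h_def)
    have eh: "e = C * h * h" by (simp add: e_def h_def power2_eq_square)
    have big: "Y \<ge> X0 \<and> Y \<ge> 1" if "Y \<ge> X / 2" for Y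
      using X2 that e2 by auto
    have PX: "\<bar>chebyshev_psi1 X - X\<^sup>2 / 2\<bar> \<le> e"
      using P1[of X] big[of X] Xe by (simp add: e_def x_def)
    have Pu: "\<bar>chebyshev_psi1 (X + h) - (X + h)\<^sup>2 / 2\<bar> \<le> 4 * e"
    proof -
      have "x \<le> ln (X + h)" unfolding x_def using Xe h by (subst ln_le_cancel_iff) auto
      then have "C * ((X + h)\<^sup>2 / (ln (X + h))\<^sup>2) \<le> C * ((2 * X)\<^sup>2 / x\<^sup>2)"
        using C Xe h x2 by (intro mult_left_mono frac_le power_mono) auto
      then show ?thesis using P1[of "X + h"] big[of "X + h"] h Xe by (simp add: e_def power_mult_distrib)
    qed
    have Pl: "\<bar>chebyshev_psi1 (X - h) - (X - h)\<^sup>2 / 2\<bar> \<le> 4 * e"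
    proof -
      have "ln (X / 2) \<le> ln (X - h)" using Xe h by (subst ln_le_cancel_iff) auto
      moreover have "ln (X / 2) = x - ln 2" using Xe by (simp add: ln_div x_def)
      ultimately have "x / 2 \<le> ln (X - h)" using ln_2_less_1 x2 by linarith
      then have "C * ((X - h)\<^sup>2 / (ln (X - h))\<^sup>2) \<le> C * (X\<^sup>2 / (x / 2)\<^sup>2)"
        using C Xe h x2 by (intro mult_left_mono frac_le power_mono) auto
      then show ?thesis using P1[of "X - h"] big[of "X - h"] h Xe by (simp add: e_def power_divide)
    qed
    have "h * chebyshev_psi X \<le> chebyshev_psi1 (X + h) - chebyshev_psi1 X"
      using chebyshev_psi1_slope(1)[of X "X + h"] h by simp
    also have "\<dots> \<le> ((X + h)\<^sup>2 / 2 + 4 * e) - (X\<^sup>2 / 2 - e)" using PX Pu by (simp add: abs_le_iff)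
    also have "\<dots> = h * (X + h / 2 + 5 * C * h)" unfolding eh by (simp add: power2_eq_square field_simps)
    finally have up: "chebyshev_psi X \<le> X + h / 2 + 5 * C * h" using h by simp
    have "h * (X - h / 2 - 5 * C * h) = (X\<^sup>2 / 2 - e) - ((X - h)\<^sup>2 / 2 + 4 * e)"
      unfolding eh by (simp add: power2_eq_square field_simps)
    also have "\<dots> \<le> chebyshev_psi1 X - chebyshev_psi1 (X - h)" using PX Pl by (simp add: abs_le_iff)
    also have "\<dots> \<le> h * chebyshev_psi X"
      using chebyshev_psi1_slope(2)[of "X - h" X] h by simp
    finally have "X - h / 2 - 5 * C * h \<le> chebyshev_psi X" using h by simp
    with up have "\<bar>chebyshev_psi X - X\<bar> \<le> h + 5 * C * h" using h by (simp add: abs_le_iff)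
    then show ?thesis by (simp add: h_def x_def algebra_simps)
  qed
  then have "eventually (\<lambda>X. norm (chebyshev_psi X - X) \<le> (1 + 5 * C) * (X / ln X)) at_top"
    unfolding real_norm_def by (rule eventually_mono[OF eventually_ge_at_top])
  moreover have "(1 + 5 * C) * (X / ln X) \<le> (1 + 5 * C) * norm (X / ln X)" for X
    unfolding real_norm_def using C by (intro mult_left_mono abs_ge_self) auto
  ultimately show ?thesis
    by (intro bigoI[of _ "1 + 5 * C"]) (auto elim!: eventually_mono intro: order_trans)
qed

definition chebyshev_theta :: "nat \<Rightarrow> real" where
  "chebyshev_theta n = (\<Sum>p | prime p \<and> p \<le> n. ln (real p))"

lemma finite_primes_le [simp]: "finite {p::nat. prime p \<and> p \<le> n}"
  by (rule finite_subset[of _ "{..n}"]) auto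

text \<open>
  A proper prime power \<open>p ^ k \<le> n\<close> has \<open>p \<le> sqrt n\<close> and \<open>k \<le> log 2 n\<close>; already counting such pairs
  is enough.
\<close>
lemma psi_minus_theta:
  assumes "n \<ge> 2"
  shows "chebyshev_theta n \<le> chebyshev_psi (real n)"
    "chebyshev_psi (real n) \<le> chebyshev_theta n + sqrt (real n) * (log 2 (real n) + 1) * ln (real n)"
proof -
  let ?A = "{m. 1 \<le> m \<and> real m \<le> real n}" and ?P = "{p. prime p \<and> p \<le> n}"
  have sub: "?P \<subseteq> ?A" by (auto simp: Suc_le_eq prime_gt_0_nat)
  have "chebyshev_psi (real n) = (\<Sum>m\<in>?P. mangoldt m) + (\<Sum>m\<in>?A - ?P. mangoldt m)"
    unfolding chebyshev_psi_def by (subst sum.subset_diff[OF sub]) auto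
  also have "(\<Sum>m\<in>?P. mangoldt m) = chebyshev_theta n"
    unfolding chebyshev_theta_def by (intro sum.cong) auto
  finally have eq: "chebyshev_psi (real n) = chebyshev_theta n + (\<Sum>m\<in>?A - ?P. mangoldt m)" .
  then show "chebyshev_theta n \<le> chebyshev_psi (real n)"
    by (simp add: sum_nonneg mangoldt_nonneg)
  define s where "s = nat \<lfloor>sqrt (real n)\<rfloor>"
  define l where "l = nat \<lfloor>log 2 (real n)\<rfloor>"
  define B where "B = (\<lambda>(p, k). p ^ k) ` ({1..s} \<times> {0..l})"
  have finB: "finite B" by (simp add: B_def)
  have cardB: "real (card B) \<le> sqrt (real n) * (log 2 (real n) + 1)"
  proof -
    have "card B \<le> card ({1..s} \<times> {0..l})" unfolding B_def by (rule card_image_le) auto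
    also have "\<dots> = s * (l + 1)" by simp
    finally have "real (card B) \<le> real (s * (l + 1))" by (simp only: of_nat_le_iff)
    also have "\<dots> = real s * (real l + 1)" by (simp add: algebra_simps)
    also have "\<dots> \<le> sqrt (real n) * (log 2 (real n) + 1)"
      using assms by (intro mult_mono) (auto simp: s_def l_def)
    finally show ?thesis .
  qed
  have inB: "m \<in> B" if "m \<in> ?A - ?P" "mangoldt m \<noteq> (0::real)" for m
  proof -
    have "primepow m" using that by (auto simp: mangoldt_def split: if_splits)
    then obtain p k where pk: "prime p" "k > 0" "m = p ^ k" by (auto simp: primepow_def)
    have "k \<noteq> 1" using that pk by auto
    with pk have k2: "k \<ge> 2" by simp
    have mn: "p ^ k \<le> n" using that pk by auto
    have p2: "p \<ge> 2" using pk by (simp add: prime_ge_2_nat)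
    have "p ^ 2 \<le> p ^ k" using k2 p2 by (intro power_increasing) auto
    with mn have "p ^ 2 \<le> n" by simp
    then have "real (p ^ 2) \<le> real n" by (simp only: of_nat_le_iff)
    then have "real p \<le> sqrt (real n)" by (intro real_le_rsqrt) simp
    then have "p \<le> s" unfolding s_def by (simp add: le_nat_floor)
    have "2 ^ k \<le> p ^ k" using p2 by (intro power_mono) auto
    with mn have "2 ^ k \<le> n" by simp
    then have "real (2 ^ k) \<le> real n" by (simp only: of_nat_le_iff)
    then have "real k \<le> log 2 (real n)" using assms by (simp add: le_log_iff powr_realpow)
    then have "k \<le> l" unfolding l_def by (simp add: le_nat_floor)
    with \<open>p \<le> s\<close> show ?thesis using p2 unfolding B_def pk(3) by force
  qed
  have "(\<Sum>m\<in>?A - ?P. mangoldt m) = (\<Sum>m\<in>(?A - ?P) \<inter> B. mangoldt m :: real)"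
    by (intro sum.mono_neutral_right) (use inB in auto)
  also have "\<dots> \<le> (\<Sum>m\<in>(?A - ?P) \<inter> B. ln (real n))"
    using mangoldt_le_ln by (intro sum_mono) (auto intro: order_trans[OF mangoldt_le_ln])
  also have "\<dots> = real (card ((?A - ?P) \<inter> B)) * ln (real n)" by simp
  also have "\<dots> \<le> real (card B) * ln (real n)"
    using finB assms by (intro mult_right_mono) (auto intro: card_mono)
  also have "\<dots> \<le> sqrt (real n) * (log 2 (real n) + 1) * ln (real n)"
    using cardB assms by (intro mult_right_mono) auto
  finally show "chebyshev_psi (real n) \<le> chebyshev_theta n + sqrt (real n) * (log 2 (real n) + 1) * ln (real n)"
    using eq by simp
qed

text \<open>The finitely many exceptions are absorbed into the constant, as \<open>g\<close> is positive from 2 on.\<close>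
lemma bigo_imp_bound_from_2:
  fixes f g :: "nat \<Rightarrow> real"
  assumes "f \<in> O(g)" and pos: "\<And>n. n \<ge> 2 \<Longrightarrow> g n > 0"
  obtains C where "C \<ge> 1" "\<And>n. n \<ge> 2 \<Longrightarrow> \<bar>f n\<bar> \<le> C * g n"
proof -
  obtain c where c: "c > 0" "eventually (\<lambda>n. norm (f n) \<le> c * norm (g n)) at_top"
    using assms(1) by (elim landau_o.bigE)
  then obtain N where N: "\<And>n. n \<ge> N \<Longrightarrow> \<bar>f n\<bar> \<le> c * \<bar>g n\<bar>"
    unfolding eventually_at_top_linorder by auto
  define C where "C = 1 + c + (\<Sum>n\<in>{2..N}. \<bar>f n\<bar> / g n)"
  have nn: "0 \<le> (\<Sum>n\<in>{2..N}. \<bar>f n\<bar> / g n)"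
    using pos by (intro sum_nonneg) (auto intro!: divide_nonneg_pos)
  show ?thesis
  proof (rule that[of C])
    show "C \<ge> 1" using c nn by (simp add: C_def)
    fix n :: nat assume n: "n \<ge> 2"
    show "\<bar>f n\<bar> \<le> C * g n"
    proof (cases "n \<ge> N")
      case True
      then have "\<bar>f n\<bar> \<le> c * g n" using N[of n] pos[OF n] by simp
      also have "\<dots> \<le> C * g n" using nn pos[OF n] by (intro mult_right_mono) (auto simp: C_def)
      finally show ?thesis .
    next
      case False
      then have "\<bar>f n\<bar> / g n \<le> (\<Sum>n\<in>{2..N}. \<bar>f n\<bar> / g n)"
        using n pos by (intro member_le_sum) (auto intro!: divide_nonneg_pos)
      then have "\<bar>f n\<bar> / g n \<le> C" using c by (simp add: C_def)
      then show ?thesis using pos[OF n] by (simp add: pos_divide_le_eq)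
    qed
  qed
qed

lemma theta_bound:
  obtains C where "C \<ge> 1" "\<And>n. n \<ge> 2 \<Longrightarrow> \<bar>chebyshev_theta n - real n\<bar> \<le> C * (real n / ln (real n))"
proof (rule bigo_imp_bound_from_2)
  have 1: "(\<lambda>n. chebyshev_psi (real n) - real n) \<in> O(\<lambda>n. real n / ln (real n))"
    using landau_o.big.compose[OF chebyshev_psi_asymptotic filterlim_real_sequentially] .
  have "(\<lambda>n. chebyshev_psi (real n) - chebyshev_theta n) \<in> O(\<lambda>n. sqrt (real n) * (log 2 (real n) + 1) * ln (real n))"
    by (rule bigoI[of _ 1], rule eventually_mono[OF eventually_ge_at_top[of 2]])
       (use psi_minus_theta in \<open>fastforce intro: order_trans[OF _ abs_ge_self]\<close>)
  also have "(\<lambda>n. sqrt (real n) * (log 2 (real n) + 1) * ln (real n)) \<in> O(\<lambda>n. real n / ln (real n))"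
    by real_asymp
  finally have "(\<lambda>n. (chebyshev_psi (real n) - real n) - (chebyshev_psi (real n) - chebyshev_theta n)) \<in> O(\<lambda>n. real n / ln (real n))"
    by (rule sum_in_bigo(2)[OF 1])
  then show "(\<lambda>n. chebyshev_theta n - real n) \<in> O(\<lambda>n. real n / ln (real n))" by simp
qed auto

section \<open>Counting primes and partial summation\<close>

definition prime_count :: "nat \<Rightarrow> nat" where
  "prime_count n = card {p. prime p \<and> p \<le> n}"

lemma primes_le_Suc:
  "{p. prime p \<and> p \<le> Suc n} = (if prime (Suc n) then insert (Suc n) {p. prime p \<and> p \<le> n} else {p. prime p \<and> p \<le> n})"
  by (auto simp: le_Suc_eq)

lemma sum_primes_Suc:
  fixes g :: "nat \<Rightarrow> real"
  shows "(\<Sum>p | prime p \<and> p \<le> Suc n. g p) = (if prime (Suc n) then g (Suc n) else 0) + (\<Sum>p | prime p \<and> p \<le> n. g p)"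
  unfolding primes_le_Suc by simp

lemma primes_le_1: "{p::nat. prime p \<and> p \<le> Suc 0} = {}"
  by (auto dest: prime_ge_2_nat)

text \<open>All primes above \<open>sqrt n\<close> contribute at least \<open>ln n / 2\<close> to \<open>chebyshev_theta n\<close>.\<close>
lemma prime_count_upper:
  assumes "n \<ge> 2"
  shows "real (prime_count n) \<le> sqrt (real n) + 2 * chebyshev_theta n / ln (real n)"
proof -
  let ?P = "{p. prime p \<and> p \<le> n}"
  define Q where "Q = {p \<in> ?P. sqrt (real n) < real p}"
  have ln0: "ln (real n) > 0" using assms by simp
  have "?P \<subseteq> {1..nat \<lfloor>sqrt (real n)\<rfloor>} \<union> Q"
  proof
    fix p assume p: "p \<in> ?P"
    show "p \<in> {1..nat \<lfloor>sqrt (real n)\<rfloor>} \<union> Q"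
    proof (cases "sqrt (real n) < real p")
      case False
      then have "p \<le> nat \<lfloor>sqrt (real n)\<rfloor>" by (intro le_nat_floor) auto
      then show ?thesis using p by (auto simp: Suc_le_eq prime_gt_0_nat)
    qed (use p in \<open>simp add: Q_def\<close>)
  qed
  then have "card ?P \<le> card ({1..nat \<lfloor>sqrt (real n)\<rfloor>} \<union> Q)"
    by (rule card_mono[rotated]) (auto simp: Q_def)
  also have "\<dots> \<le> nat \<lfloor>sqrt (real n)\<rfloor> + card Q"
    using card_Un_le[of "{1..nat \<lfloor>sqrt (real n)\<rfloor>}" Q] by simp
  finally have "prime_count n \<le> nat \<lfloor>sqrt (real n)\<rfloor> + card Q" by (simp add: prime_count_def)
  then have "real (prime_count n) \<le> real (nat \<lfloor>sqrt (real n)\<rfloor>) + real (card Q)"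
    unfolding of_nat_add[symmetric] by (simp only: of_nat_le_iff)
  also have "real (nat \<lfloor>sqrt (real n)\<rfloor>) \<le> sqrt (real n)" by simp
  also have "real (card Q) \<le> 2 * chebyshev_theta n / ln (real n)"
  proof -
    have "real (card Q) * (ln (real n) / 2) = (\<Sum>p\<in>Q. ln (real n) / 2)" by simp
    also have "\<dots> \<le> (\<Sum>p\<in>Q. ln (real p))"
    proof (rule sum_mono)
      fix p assume "p \<in> Q"
      then have p0: "p > 0" and "sqrt (real n) \<le> real p" by (auto simp: Q_def prime_gt_0_nat)
      from this(2) have "ln (sqrt (real n)) \<le> ln (real p)" using assms p0 by (subst ln_le_cancel_iff) auto
      then show "ln (real n) / 2 \<le> ln (real p)" using assms by (simp add: ln_sqrt)
    qed
    also have "\<dots> \<le> chebyshev_theta n" unfolding chebyshev_theta_def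
      by (intro sum_mono2) (auto simp: Q_def prime_ge_1_nat Suc_le_eq prime_gt_0_nat)
    finally show ?thesis using ln0 by (simp add: field_simps)
  qed
  finally show ?thesis by simp
qed

lemma prime_count_chebyshev:
  obtains C where "C \<ge> 1" "\<And>n. n \<ge> 2 \<Longrightarrow> real (prime_count n) \<le> C * (real n / ln (real n))"
proof -
  obtain D where D: "D \<ge> 1" "\<And>n. n \<ge> 2 \<Longrightarrow> \<bar>chebyshev_theta n - real n\<bar> \<le> D * (real n / ln (real n))"
    using theta_bound by blast
  have "(\<lambda>n. real (prime_count n)) \<in> O(\<lambda>n. sqrt (real n) + 2 * (real n + D * (real n / ln (real n))) / ln (real n))"
  proof (rule bigoI[of _ 1], rule eventually_mono[OF eventually_ge_at_top[of 2]])
    fix n :: nat assume n: "n \<ge> 2"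
    have "2 * chebyshev_theta n / ln (real n) \<le> 2 * (real n + D * (real n / ln (real n))) / ln (real n)"
      using D(2)[OF n] n by (intro divide_right_mono mult_left_mono) auto
    with prime_count_upper[OF n] show "norm (real (prime_count n)) \<le> 1 * norm (sqrt (real n) + 2 * (real n + D * (real n / ln (real n))) / ln (real n))"
      by (auto intro: order_trans[OF _ abs_ge_self])
  qed
  also have "(\<lambda>n. sqrt (real n) + 2 * (real n + D * (real n / ln (real n))) / ln (real n)) \<in> O(\<lambda>n. real n / ln (real n))"
    by real_asymp
  finally show ?thesis
    by (rule bigo_imp_bound_from_2) (use that in auto)
qed

lemma ln_Suc_diff_le:
  assumes "k \<ge> 1"
  shows "ln (real (Suc k)) - ln (real k) \<le> 1 / real k"
proof -
  have "ln (real (Suc k)) - ln (real k) = ln (1 + 1 / real k)"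
    using assms ln_div[of "real (Suc k)" "real k"] by (simp add: add_divide_distrib add.commute)
  also have "\<dots> \<le> 1 / real k" by (rule ln_add_one_self_le_self) simp
  finally show ?thesis .
qed

text \<open>When \<open>n\<close> increases by one, each prime already counted adds \<open>ln (n + 1) - ln n \<le> 1 / n\<close>, and a new one adds 0.\<close>
lemma sum_ln_prime_ratio:
  assumes "n \<ge> 1"
  shows "(\<Sum>p | prime p \<and> p \<le> n. ln (real n) - ln (real p)) \<le> (\<Sum>k\<in>{2..<n}. real (prime_count k) / real k)"
  using assms
proof (induction n rule: dec_induct)
  case base
  then show ?case by (simp add: primes_le_1)
next
  case (step n)
  have "(\<Sum>p | prime p \<and> p \<le> Suc n. ln (real (Suc n)) - ln (real p)) = (\<Sum>p | prime p \<and> p \<le> n. ln (real (Suc n)) - ln (real p))"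
    unfolding sum_primes_Suc by simp
  also have "\<dots> = (\<Sum>p | prime p \<and> p \<le> n. ln (real n) - ln (real p)) + real (prime_count n) * (ln (real (Suc n)) - ln (real n))"
    by (simp add: sum_subtractf prime_count_def algebra_simps)
  also have "\<dots> \<le> (\<Sum>k\<in>{2..<n}. real (prime_count k) / real k) + real (prime_count n) * (1 / real n)"
    using step ln_Suc_diff_le[of n] by (intro add_mono mult_left_mono) auto
  also have "\<dots> = (\<Sum>k\<in>{2..<Suc n}. real (prime_count k) / real k)"
  proof (cases "n \<ge> 2")
    case False
    then have "n = 1" using step by simp
    then show ?thesis by (simp add: prime_count_def primes_le_1)
  qed simp
  finally show ?case .
qed

text \<open>Terms with \<open>k \<le> sqrt n\<close> are at most \<open>1 / ln 2\<close>, the others at most \<open>2 / ln n\<close>.\<close>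
lemma sum_inverse_ln:
  assumes "n \<ge> 2"
  shows "(\<Sum>k\<in>{2..<n}. 1 / ln (real k)) \<le> sqrt (real n) / ln 2 + 2 * (real n / ln (real n))"
proof -
  let ?s = "nat \<lfloor>sqrt (real n)\<rfloor>"
  have ln0: "ln (real n) > 0" using assms by simp
  have "(\<Sum>k\<in>{2..<n}. 1 / ln (real k)) \<le> (\<Sum>k\<in>{2..<n}. (if k \<le> ?s then 1 / ln 2 else 0) + 2 / ln (real n))"
  proof (rule sum_mono)
    fix k assume k: "k \<in> {2..<n}"
    show "1 / ln (real k) \<le> (if k \<le> ?s then 1 / ln 2 else 0) + 2 / ln (real n)"
    proof (cases "k \<le> ?s")
      case True
      have "1 / ln (real k) \<le> 1 / ln 2" using k by (intro divide_left_mono) auto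
      moreover have "0 \<le> 2 / ln (real n)" using ln0 by simp
      ultimately have "1 / ln (real k) \<le> 1 / ln 2 + 2 / ln (real n)" by linarith
      then show ?thesis using True by simp
    next
      case False
      then have "sqrt (real n) \<le> real k" by (meson le_nat_floor linear not_le order.order_iff_strict)
      then have "ln (sqrt (real n)) \<le> ln (real k)" using assms k by (subst ln_le_cancel_iff) auto
      then have "ln (real n) / 2 \<le> ln (real k)" using assms by (simp add: ln_sqrt)
      then have "1 / ln (real k) \<le> 1 / (ln (real n) / 2)" using ln0 k by (intro divide_left_mono) auto
      then show ?thesis using False by simp
    qed
  qed
  also have "\<dots> = real (card ({2..<n} \<inter> {..?s})) * (1 / ln 2) + real (n - 2) * (2 / ln (real n))"
    by (simp add: sum.distrib sum.If_cases atMost_def)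
  also have "\<dots> \<le> sqrt (real n) * (1 / ln 2) + real n * (2 / ln (real n))"
  proof (intro add_mono mult_right_mono)
    have "card ({2..<n} \<inter> {..?s}) \<le> card {1..?s}" by (intro card_mono) auto
    then have "card ({2..<n} \<inter> {..?s}) \<le> ?s" by simp
    then have "real (card ({2..<n} \<inter> {..?s})) \<le> real ?s" by (simp only: of_nat_le_iff)
    also have "\<dots> \<le> sqrt (real n)" by simp
    finally show "real (card ({2..<n} \<inter> {..?s})) \<le> sqrt (real n)" .
  qed (use ln0 in auto)
  finally show ?thesis by (simp add: mult.commute)
qed

text \<open>
  Since \<open>\<pi>(n) ln n - \<theta>(n)\<close> is the sum of \<open>ln (n / p)\<close> over the primes \<open>p \<le> n\<close>, which is \<open>O(n / ln n)\<close>
  by the Chebyshev bound, dividing the asymptotics of \<open>\<theta>\<close> by \<open>ln n\<close> is all that remains.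
\<close>
lemma prime_count_bound:
  obtains C where "C \<ge> 1" "\<And>n. n \<ge> 2 \<Longrightarrow> \<bar>real (prime_count n) - real n / ln (real n)\<bar> \<le> C * (real n / (ln (real n))\<^sup>2)"
proof -
  obtain D where D: "D \<ge> 1" "\<And>n. n \<ge> 2 \<Longrightarrow> \<bar>chebyshev_theta n - real n\<bar> \<le> D * (real n / ln (real n))"
    using theta_bound by blast
  obtain K where K: "K \<ge> 1" "\<And>n. n \<ge> 2 \<Longrightarrow> real (prime_count n) \<le> K * (real n / ln (real n))"
    using prime_count_chebyshev by blast
  define L where "L = (\<lambda>n. \<Sum>p | prime p \<and> p \<le> n. ln (real n) - ln (real p))"
  have L: "0 \<le> L n" "L n \<le> K * (sqrt (real n) / ln 2 + 2 * (real n / ln (real n)))" if "n \<ge> 2" for n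
  proof -
    show "0 \<le> L n" unfolding L_def using that by (intro sum_nonneg) (auto simp: prime_gt_0_nat)
    have "L n \<le> (\<Sum>k\<in>{2..<n}. real (prime_count k) / real k)"
      unfolding L_def using that by (intro sum_ln_prime_ratio) auto
    also have "\<dots> \<le> (\<Sum>k\<in>{2..<n}. K * (1 / ln (real k)))"
    proof (rule sum_mono)
      fix k assume "k \<in> {2..<n}"
      then have "real (prime_count k) / real k \<le> K * (real k / ln (real k)) / real k"
        by (intro divide_right_mono K) auto
      then show "real (prime_count k) / real k \<le> K * (1 / ln (real k))" using \<open>k \<in> {2..<n}\<close> by simp
    qed
    also have "\<dots> = K * (\<Sum>k\<in>{2..<n}. 1 / ln (real k))" by (simp add: sum_distrib_left)
    also have "\<dots> \<le> K * (sqrt (real n) / ln 2 + 2 * (real n / ln (real n)))"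
      using K that by (intro mult_left_mono sum_inverse_ln) auto
    finally show "L n \<le> K * (sqrt (real n) / ln 2 + 2 * (real n / ln (real n)))" .
  qed
  have eq: "real (prime_count n) - real n / ln (real n) = (chebyshev_theta n - real n) / ln (real n) + L n / ln (real n)" if "n \<ge> 2" for n
  proof -
    have "L n = real (prime_count n) * ln (real n) - chebyshev_theta n"
      by (simp add: L_def sum_subtractf prime_count_def chebyshev_theta_def)
    then show ?thesis using that by (simp add: field_simps)
  qed
  have "(\<lambda>n. real (prime_count n) - real n / ln (real n)) \<in>
      O(\<lambda>n. D * (real n / ln (real n)) / ln (real n) + K * (sqrt (real n) / ln 2 + 2 * (real n / ln (real n))) / ln (real n))"
  proof (rule bigoI[of _ 1], rule eventually_mono[OF eventually_ge_at_top[of 2]])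
    fix n :: nat assume n: "n \<ge> 2"
    have "\<bar>real (prime_count n) - real n / ln (real n)\<bar> \<le> \<bar>(chebyshev_theta n - real n) / ln (real n)\<bar> + \<bar>L n / ln (real n)\<bar>"
      unfolding eq[OF n] by (rule abs_triangle_ineq)
    also have "\<bar>(chebyshev_theta n - real n) / ln (real n)\<bar> \<le> D * (real n / ln (real n)) / ln (real n)"
    proof -
      have "\<bar>ln (real n)\<bar> = ln (real n)" using n by simp
      then show ?thesis unfolding abs_divide using D(2)[OF n] n by (metis divide_right_mono abs_ge_zero)
    qed
    also have "\<bar>L n / ln (real n)\<bar> \<le> K * (sqrt (real n) / ln 2 + 2 * (real n / ln (real n))) / ln (real n)"
      using L[OF n] n by (simp add: abs_divide divide_right_mono)
    finally show "norm (real (prime_count n) - real n / ln (real n)) \<le> 1 * norm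
        (D * (real n / ln (real n)) / ln (real n) + K * (sqrt (real n) / ln 2 + 2 * (real n / ln (real n))) / ln (real n))"
      by (auto intro: order_trans[OF _ abs_ge_self])
  qed
  also have "(\<lambda>n. D * (real n / ln (real n)) / ln (real n) + K * (sqrt (real n) / ln 2 + 2 * (real n / ln (real n))) / ln (real n))
      \<in> O(\<lambda>n. real n / (ln (real n))\<^sup>2)"
    by real_asymp
  finally show ?thesis
    by (rule bigo_imp_bound_from_2) (use that in auto)
qed

lemma ln_squared_le: "t \<ge> 1 \<Longrightarrow> (ln t)\<^sup>2 \<le> 4 * (t::real)"
proof -
  assume t: "t \<ge> 1"
  have "ln t = 2 * ln (sqrt t)" using t by (simp add: ln_sqrt)
  also have "ln (sqrt t) \<le> sqrt t" using t ln_le_minus_one[of "sqrt t"] by simp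
  finally have "ln t \<le> 2 * sqrt t" by simp
  then have "(ln t)\<^sup>2 \<le> (2 * sqrt t)\<^sup>2" using t by (intro power_mono) auto
  then show ?thesis using t by (simp add: power_mult_distrib)
qed

lemma ln_2_ge_half: "ln 2 \<ge> (1/2 :: real)"
  by (rule iffD2[OF ln_ge_iff]) (simp_all add: exp_half_le2)

definition prime_count_error :: "real \<Rightarrow> real" where
  "prime_count_error t = real (prime_count (nat \<lfloor>t\<rfloor>)) - t / ln t"

text \<open>
  Between consecutive integers \<open>t / ln t\<close> varies by a bounded amount, while \<open>t / (ln t)\<^sup>2\<close> is bounded below.
\<close>
lemma prime_count_error_bound:
  obtains C where "C \<ge> 1" "\<And>t. t \<ge> 2 \<Longrightarrow> \<bar>prime_count_error t\<bar> \<le> C * (t / (ln t)\<^sup>2)"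
proof -
  obtain K where K: "K \<ge> 1" "\<And>n. n \<ge> 2 \<Longrightarrow> \<bar>real (prime_count n) - real n / ln (real n)\<bar> \<le> K * (real n / (ln (real n))\<^sup>2)"
    using prime_count_bound by blast
  show ?thesis
  proof (rule that[of "4 * K + 16"])
    fix t :: real assume t: "t \<ge> 2"
    define n where "n = nat \<lfloor>t\<rfloor>"
    have n: "n \<ge> 2" "real n \<le> t" "t \<le> real n + 1" using t by (auto simp: n_def le_nat_floor)
    have l: "ln (real n) \<ge> 1/2" "ln t \<ge> ln (real n)" "ln t > 0"
    proof -
      have "ln 2 \<le> ln (real n)" using n by simp
      then show "ln (real n) \<ge> 1/2" using ln_2_ge_half by linarith
      show "ln t \<ge> ln (real n)" "ln t > 0" using n t by auto
    qed
    have d: "\<bar>real n / ln (real n) - t / ln t\<bar> \<le> 4"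
    proof -
      have "t / ln t \<le> t / ln (real n)" using l t by (intro divide_left_mono) auto
      also have "\<dots> \<le> (real n + 1) / ln (real n)" using l n by (intro divide_right_mono) auto
      also have "\<dots> = real n / ln (real n) + 1 / ln (real n)" by (simp add: add_divide_distrib)
      also have "1 / ln (real n) \<le> 1 / (1/2)" using l by (intro divide_left_mono) auto
      finally have 1: "t / ln t \<le> real n / ln (real n) + 2" by simp
      have "ln t - ln (real n) \<le> ln (real (Suc n)) - ln (real n)" using n t by simp
      also have "\<dots> \<le> 1 / real n" using n by (intro ln_Suc_diff_le) auto
      finally have dl: "real n * (ln t - ln (real n)) \<le> 1" using n by (simp add: field_simps)
      have "real n / ln (real n) - real n / ln t = real n * (ln t - ln (real n)) / (ln (real n) * ln t)"
        using l by (simp add: field_simps)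
      also have "\<dots> \<le> 1 / ((1/2) * (1/2))" using dl l n order_trans[OF l(1,2)] by (intro frac_le mult_mono) auto
      finally have "real n / ln (real n) - real n / ln t \<le> 4" by simp
      moreover have "real n / ln t \<le> t / ln t" using n l by (intro divide_right_mono) auto
      ultimately show ?thesis using 1 by (simp add: abs_le_iff)
    qed
    have ln2n: "ln t \<le> 2 * ln (real n)"
    proof -
      have "2 * real n \<le> real n * real n" using n by (intro mult_right_mono) auto
      moreover have "t \<le> 2 * real n" using n by linarith
      ultimately have "t \<le> real n * real n" by linarith
      then have "ln t \<le> ln (real n * real n)" using t n by (subst ln_le_cancel_iff) auto
      then show ?thesis using n by (simp add: ln_mult)
    qed
    have "real n / (ln (real n))\<^sup>2 \<le> t / (ln t / 2)\<^sup>2"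
      using n l ln2n t by (intro frac_le power_mono) auto
    also have "\<dots> = 4 * (t / (ln t)\<^sup>2)" by (simp add: power_divide)
    finally have "K * (real n / (ln (real n))\<^sup>2) \<le> K * (4 * (t / (ln t)\<^sup>2))"
      using K by (intro mult_left_mono) auto
    then have m: "K * (real n / (ln (real n))\<^sup>2) \<le> 4 * K * (t / (ln t)\<^sup>2)"
      by (simp only: mult_ac)
    have "4 \<le> 16 * (t / (ln t)\<^sup>2)" using ln_squared_le[of t] t l by (simp add: pos_le_divide_eq)
    then show "\<bar>prime_count_error t\<bar> \<le> (4 * K + 16) * (t / (ln t)\<^sup>2)"
      using d m K(2)[OF n(1)] unfolding prime_count_error_def n_def[symmetric] distrib_right
      by argo
  qed (use K in auto)
qed

text \<open>
  Abel summation by induction on \<open>n\<close>: the prime counting function is constant on \<open>[n, n + 1)\<close>, and its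
  value at the single point \<open>n + 1\<close> does not affect the integral. The induction starts with the one-point
  interval at 2, where the only prime contributes \<open>f 2\<close> to both terms.
\<close>
lemma prime_sum_by_parts:
  fixes f f' :: "real \<Rightarrow> real"
  assumes der: "\<And>t. t \<ge> 2 \<Longrightarrow> (f has_real_derivative f' t) (at t within {2..})" and n: "n \<ge> 2"
  shows "((\<lambda>t. real (prime_count (nat \<lfloor>t\<rfloor>)) * f' t) has_integral
           (real (prime_count n) * f (real n) - (\<Sum>p | prime p \<and> p \<le> n. f (real p)))) {2..real n}"
  using n
proof (induction n rule: dec_induct)
  case base
  have P: "{p::nat. prime p \<and> p \<le> 2} = {2}"
    using prime_ge_2_nat by (auto simp: le_antisym)
  show ?case using has_integral_null_real[of 2 2] by (simp add: P prime_count_def)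
next
  case (step n)
  have "((\<lambda>t. real (prime_count n) * f' t) has_integral real (prime_count n) * (f (real (Suc n)) - f (real n))) {real n..real (Suc n)}"
  proof (intro has_integral_mult_right fundamental_theorem_of_calculus)
    fix t assume t: "t \<in> {real n..real (Suc n)}"
    show "(f has_vector_derivative f' t) (at t within {real n..real (Suc n)})"
      unfolding has_real_derivative_iff_has_vector_derivative[symmetric]
      by (rule DERIV_subset[OF der]) (use step t in auto)
  qed auto
  then have "((\<lambda>t. real (prime_count (nat \<lfloor>t\<rfloor>)) * f' t) has_integral real (prime_count n) * (f (real (Suc n)) - f (real n))) {real n..real (Suc n)}"
  proof (rule has_integral_spike_finite[of "{real (Suc n)}", rotated 2])
    fix t assume "t \<in> {real n..real (Suc n)} - {real (Suc n)}"
    then have "nat \<lfloor>t\<rfloor> = n" by (auto simp: floor_eq_iff nat_eq_iff) 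
    then show "real (prime_count (nat \<lfloor>t\<rfloor>)) * f' t = real (prime_count n) * f' t" by simp
  qed auto
  from has_integral_combine[OF _ _ step.IH this]
  have "((\<lambda>t. real (prime_count (nat \<lfloor>t\<rfloor>)) * f' t) has_integral
     (real (prime_count n) * f (real n) - (\<Sum>p | prime p \<and> p \<le> n. f (real p))) + real (prime_count n) * (f (real (Suc n)) - f (real n))) {2..real (Suc n)}"
    using step by simp
  also have "(real (prime_count n) * f (real n) - (\<Sum>p | prime p \<and> p \<le> n. f (real p))) + real (prime_count n) * (f (real (Suc n)) - f (real n))
      = real (prime_count (Suc n)) * f (real (Suc n)) - (\<Sum>p | prime p \<and> p \<le> Suc n. f (real p))"
    unfolding sum_primes_Suc by (simp add: prime_count_def primes_le_Suc algebra_simps)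
  finally show ?case .
qed

theorem mainTheorem1:
  fixes f f' :: "real \<Rightarrow> real"
  assumes "\<And>t. t \<ge> 2 \<Longrightarrow> (f has_real_derivative f' t) (at t within {2..})"
    and "continuous_on {2..} f'"
  shows "\<exists>E1 \<in> bigO_ge2 (\<lambda>n. real n * \<bar>f (real n)\<bar> / (ln (real n))\<^sup>2).
         \<exists>E2 \<in> bigO_ge2 (\<lambda>n. integral {2..real n} (\<lambda>t. t * \<bar>f' t\<bar> / (ln t)\<^sup>2)).
           \<forall>n\<ge>2. (\<Sum>p | prime (p::nat) \<and> p \<le> n. f (real p)) =
             real n * f (real n) / ln (real n) + E1 n
             - integral {2..real n} (\<lambda>t. t * f' t / ln t) + E2 n"
proof -
  obtain C where C: "C \<ge> 1" "\<And>t. t \<ge> 2 \<Longrightarrow> \<bar>prime_count_error t\<bar> \<le> C * (t / (ln t)\<^sup>2)"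
    using prime_count_error_bound by blast
  define E1 where "E1 = (\<lambda>n. prime_count_error (real n) * f (real n))"
  define E2 where "E2 = (\<lambda>n. - integral {2..real n} (\<lambda>t. prime_count_error t * f' t))"
  have cont: "continuous_on {2..real n} f'" for n
    using assms(2) by (rule continuous_on_subset) auto
  have main: "((\<lambda>t. t * f' t / ln t) has_integral integral {2..real n} (\<lambda>t. t * f' t / ln t)) {2..real n}" for n
    by (intro integrable_integral integrable_continuous_real continuous_intros cont) auto
  have bint: "(\<lambda>t. t * \<bar>f' t\<bar> / (ln t)\<^sup>2) integrable_on {2..real n}" for n
    by (intro integrable_continuous_real continuous_intros cont) auto
  have err: "((\<lambda>t. prime_count_error t * f' t) has_integral
      (real (prime_count n) * f (real n) - (\<Sum>p | prime p \<and> p \<le> n. f (real p))) - integral {2..real n} (\<lambda>t. t * f' t / ln t)) {2..real n}"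
    if "n \<ge> 2" for n
    using has_integral_diff[OF prime_sum_by_parts[OF assms(1) that] main[of n]]
    by (simp add: prime_count_error_def algebra_simps)
  show ?thesis
  proof (intro bexI allI impI)
    show "E1 \<in> bigO_ge2 (\<lambda>n. real n * \<bar>f (real n)\<bar> / (ln (real n))\<^sup>2)"
      unfolding bigO_ge2_def
    proof (intro CollectI exI[of _ C] allI impI)
      fix n :: nat assume "n \<ge> 2"
      then have "\<bar>prime_count_error (real n)\<bar> * \<bar>f (real n)\<bar> \<le> C * (real n / (ln (real n))\<^sup>2) * \<bar>f (real n)\<bar>"
        by (intro mult_right_mono C) auto
      then show "\<bar>E1 n\<bar> \<le> C * (real n * \<bar>f (real n)\<bar> / (ln (real n))\<^sup>2)"
        by (simp add: E1_def abs_mult)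
    qed
    show "E2 \<in> bigO_ge2 (\<lambda>n. integral {2..real n} (\<lambda>t. t * \<bar>f' t\<bar> / (ln t)\<^sup>2))"
      unfolding bigO_ge2_def
    proof (intro CollectI exI[of _ C] allI impI)
      fix n :: nat assume n: "n \<ge> 2"
      have "norm (integral {2..real n} (\<lambda>t. prime_count_error t * f' t)) \<le> integral {2..real n} (\<lambda>t. C * (t * \<bar>f' t\<bar> / (ln t)\<^sup>2))"
      proof (rule integral_norm_bound_integral)
        show "(\<lambda>t. prime_count_error t * f' t) integrable_on {2..real n}" using err[OF n] by blast
        show "(\<lambda>t. C * (t * \<bar>f' t\<bar> / (ln t)\<^sup>2)) integrable_on {2..real n}"
          using bint by (rule integrable_on_mult_right)
        fix t assume "t \<in> {2..real n}"
        then have "\<bar>prime_count_error t\<bar> * \<bar>f' t\<bar> \<le> C * (t / (ln t)\<^sup>2) * \<bar>f' t\<bar>"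
          by (intro mult_right_mono C) auto
        then show "norm (prime_count_error t * f' t) \<le> C * (t * \<bar>f' t\<bar> / (ln t)\<^sup>2)"
          by (simp add: abs_mult)
      qed
      then show "\<bar>E2 n\<bar> \<le> C * integral {2..real n} (\<lambda>t. t * \<bar>f' t\<bar> / (ln t)\<^sup>2)"
        unfolding integral_mult_right by (simp add: E2_def)
    qed
    fix n :: nat assume n: "n \<ge> 2"
    show "(\<Sum>p | prime p \<and> p \<le> n. f (real p)) = real n * f (real n) / ln (real n) + E1 n
             - integral {2..real n} (\<lambda>t. t * f' t / ln t) + E2 n"
      using integral_unique[OF err[OF n]] by (simp add: E1_def E2_def prime_count_error_def algebra_simps)
  qed
qed

end
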